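(* Let $\gamma(t)=(x(t),y_1(t),\dots,y_n(t))\in\mathbb{C}[[t]]^{n+1}$ be a parametrization of a (not necessarily smooth) space algebraic curve $X\subseteq\mathbb{A}^{n+1}_{\mathbb{C}}$. Further, let $f_1,\dots,f_r\in\mathbb{C}[x,y_1,\dots,y_n]$ be its defining polynomials. Then for $p(t)$ a rational function in the higher derivatives of the components of $\gamma(t)$, the following statements are equivalent: (i) $p(t)$ is a geometric invariant, i.e., it is equivariant under reparametrizations. (ii) $p(t)$ can be written as a rational function in $s_j(t)$ and $\kappa_{i,j}(t)$, for $1\le j\le n$ and $i\ge1$. Moreover, $p(t)$ is invariant under the substitution $$i_\kappa:\quad x'(t)\mapsto 1,\quad \partial_t^ix(t)\mapsto 0\ \text{ for all } i\ge2,\quad y_j'(t)\mapsto s_j(t),\quad \partial_t^iy_j(t)\mapsto\kappa_{i-1,j}(t)\ \text{ for all } i\ge2,\ \text{ and } j=1,\dots,n.$$ (iii) There exist polynomials $$\tilde p_1,\tilde p_2\in\mathbb{C}[\partial_x^{i_0}\partial_{y_1}^{i_1}\cdots\partial_{y_n}^{i_n}f_k : i_0,\dots,i_n\in\mathbb{N},\ 1\le k\le r]\subseteq\mathbb{C}[x,y_1,\dots,y_n]$$ such that the equality $$p(t)=\frac{\tilde p_1(\gamma(t))}{\tilde p_2(\gamma(t))}$$ is fulfilled. In other words, $p(t)$ admits an implicit expression as a rational function in terms of the higher partial derivatives of the defining equations $f_1,\dots,f_r$ of $X$.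
   Context: $\mathbb{N}=\{0,1,2,\dots\}$. The defining polynomials $f_1,\dots,f_r$ are generators of the radical ideal $I$ defining $X$. A parametrization of $X$ (at the origin) is a tuple $\gamma(t)=(x(t),y_1(t),\dots,y_n(t))\in\mathbb{C}[[t]]^{n+1}$ of power series with $\gamma(0)=0$ for which the ring map $\mathbb{C}[[x,y_1,\dots,y_n]]/I\to\mathbb{C}[[t]]$, $x\mapsto x(t)$, $y_j\mapsto y_j(t)$, is injective. The slopes and the first and higher algebraic curvatures are $$s_j(t)=\frac{y_j'(t)}{x'(t)},\qquad \kappa_{1,j}(t)=\frac{y_j''(t)x'(t)-y_j'(t)x''(t)}{x'(t)^3},\qquad \kappa_{i,j}(t)=\frac{\partial_t\kappa_{i-1,j}(t)}{x'(t)}\ (i\ge2),\qquad 1\le j\le n.$$ A reparametrization is an algebra automorphism of $\mathbb{C}[[t]]$, given by a power series $\varphi(t)\in\mathbb{C}[[t]]$ with $\operatorname{ord}\varphi(t)=1$; it acts on $\gamma$ by componentwise composition $\gamma\circ\varphi$. A rational expression $p$ in the components of $\gamma(t)$ and their derivatives is equivariant under reparametrizations if $$p\bigl(\partial_t^ix(t),\partial_t^iy_j(t)\bigr)\circ\varphi(t)=p\bigl(\partial_t^i(x\circ\varphi)(t),\partial_t^i(y_j\circ\varphi)(t)\bigr)$$ for all reparametrizations $\varphi$; such an expression is called a geometric invariant.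
   Formalization: The equalities for p(t) in (ii) and (iii), and i_κ-invariance, are required for γ and all its reparametrizations where p is defined; x'(t)≠0 is assumed; i_κ-invariance is stated with denominators cleared, allowing 0/0. *)

theory Defs
  imports
    "HOL-Library.Poly_Mapping"
    "HOL-Library.Extended_Nat"
    "HOL-Computational_Algebra.Formal_Laurent_Series"
    Complex_Main
begin

section \<open>Polynomials, ideals and algebraic sets\<close>

text \<open>
  Monomials in variables of type \<open>'v\<close> are finitely supported exponent vectors, and
  \<open>'v mpol\<close> is the polynomial ring over the complex numbers in these variables. The ring structure is
  the convolution product of \<open>Poly_Mapping\<close>.
\<close>

type_synonym 'v monom = "'v \<Rightarrow>\<^sub>0 nat"
type_synonym 'v mpol = "'v monom \<Rightarrow>\<^sub>0 complex"

text \<open>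
  Evaluation at \<open>a\<close> in a complex algebra; \<open>h\<close> is the structure map embedding the
  coefficients.
\<close>

definition mpol_eval :: "(complex \<Rightarrow> 'b::comm_ring_1) \<Rightarrow> ('v \<Rightarrow> 'b) \<Rightarrow> 'v mpol \<Rightarrow> 'b" where
  "mpol_eval h a P =
     (\<Sum>m\<in>Poly_Mapping.keys P. h (Poly_Mapping.lookup P m) *
        (\<Prod>v\<in>Poly_Mapping.keys m. a v ^ Poly_Mapping.lookup m v))"

definition mpol_deriv :: "'v \<Rightarrow> 'v mpol \<Rightarrow> 'v mpol" where
  "mpol_deriv v P =
     (\<Sum>m\<in>Poly_Mapping.keys P.
        Poly_Mapping.single (m - Poly_Mapping.single v 1)
          (of_nat (Poly_Mapping.lookup m v) * Poly_Mapping.lookup P m))"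

definition ideal_gen :: "nat \<Rightarrow> (nat \<Rightarrow> 'v mpol) \<Rightarrow> 'v mpol set" where
  "ideal_gen r f = {\<Sum>k=1..r. g k * f k | g. True}"

definition radical_ideal :: "'v mpol set \<Rightarrow> bool" where
  "radical_ideal I \<longleftrightarrow> (\<forall>g m. g ^ m \<in> I \<longrightarrow> g \<in> I)"

definition zero_locus :: "'v mpol set \<Rightarrow> ('v \<Rightarrow> complex) set" where
  "zero_locus S = {a. \<forall>g\<in>S. mpol_eval (\<lambda>c. c) a g = 0}"

definition zariski_closed :: "('v \<Rightarrow> complex) set \<Rightarrow> bool" where
  "zariski_closed Z \<longleftrightarrow> (\<exists>S. Z = zero_locus S)"

definition zariski_irreducible :: "('v \<Rightarrow> complex) set \<Rightarrow> bool" where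
  "zariski_irreducible Z \<longleftrightarrow> zariski_closed Z \<and> Z \<noteq> {} \<and>
     (\<forall>Z1 Z2. zariski_closed Z1 \<and> zariski_closed Z2 \<and> Z \<subseteq> Z1 \<union> Z2 \<longrightarrow> Z \<subseteq> Z1 \<or> Z \<subseteq> Z2)"

text \<open>Krull dimension: the supremum of the lengths of chains of irreducible closed subsets.\<close>

definition zariski_dim :: "('v \<Rightarrow> complex) set \<Rightarrow> enat" where
  "zariski_dim X = Sup {enat d | d.
     \<exists>Z. (\<forall>i\<le>d. zariski_irreducible (Z i) \<and> Z i \<subseteq> X) \<and> (\<forall>i<d. Z i \<subset> Z (Suc i))}"

text \<open>Curves may be singular and reducible.\<close>

definition algebraic_curve :: "('v \<Rightarrow> complex) set \<Rightarrow> bool" where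
  "algebraic_curve X \<longleftrightarrow> zariski_closed X \<and> zariski_dim X = 1"

text \<open>
  The subalgebra of the polynomial ring generated by all the partial derivatives (including
  those of order zero) of \<open>f\<^sub>1, \<dots>, f\<^sub>r\<close>. Partial derivatives commute, so the lists \<open>vs\<close> range over
  all multi-indices.
\<close>

inductive_set partials_algebra :: "nat \<Rightarrow> (nat \<Rightarrow> 'v mpol) \<Rightarrow> 'v mpol set"
  for r :: nat and f :: "nat \<Rightarrow> 'v mpol" where
  const: "Poly_Mapping.single 0 c \<in> partials_algebra r f"
| gen: "1 \<le> k \<Longrightarrow> k \<le> r \<Longrightarrow> foldr mpol_deriv vs (f k) \<in> partials_algebra r f"
| add: "P \<in> partials_algebra r f \<Longrightarrow> Q \<in> partials_algebra r f \<Longrightarrow> P + Q \<in> partials_algebra r f"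
| mult: "P \<in> partials_algebra r f \<Longrightarrow> Q \<in> partials_algebra r f \<Longrightarrow> P * Q \<in> partials_algebra r f"

section \<open>Parametrizations\<close>

text \<open>
  The ambient space has the coordinate \<open>x = None\<close> and one coordinate \<open>y\<^sub>j = Some j\<close> for each
  \<open>j\<close> of a finite type \<open>'n\<close>, so that \<open>n = CARD('n) \<ge> 1\<close>. A tuple \<open>\<gamma>\<close> of power series has the
  components \<open>\<gamma> None\<close> and \<open>\<gamma> (Some j)\<close>.

  A formal power series in several variables is given by its coefficients. The function
  \<open>Poly_Mapping.lookup\<close> embeds polynomials into power series.
\<close>

type_synonym 'v mps = "'v monom \<Rightarrow> complex"

definition mps_mult :: "'v mps \<Rightarrow> 'v mps \<Rightarrow> 'v mps" where
  "mps_mult F G = (\<lambda>m. \<Sum>(a, b)\<in>{(a, b). a + b = m}. F a * G b)"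

text \<open>The extension of the polynomial ideal generated by \<open>f\<^sub>1, \<dots>, f\<^sub>r\<close> to the power series ring.\<close>

definition mps_ideal_gen :: "nat \<Rightarrow> (nat \<Rightarrow> 'v mpol) \<Rightarrow> 'v mps set" where
  "mps_ideal_gen r f = {\<lambda>m. \<Sum>k=1..r. mps_mult (G k) (Poly_Mapping.lookup (f k)) m | G. True}"

text \<open>
  Substitution of \<open>\<gamma>\<close> with \<open>\<gamma>(0) = 0\<close> into a power series. A monomial of total degree \<open>d\<close> then
  becomes a series of order at least \<open>d\<close>, so only the monomials of degree at most \<open>k\<close> contribute to
  the coefficient of \<open>t\<^sup>k\<close>.
\<close>

definition mps_subst :: "('v::finite \<Rightarrow> complex fps) \<Rightarrow> 'v mps \<Rightarrow> complex fps" where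
  "mps_subst \<gamma> F = Abs_fps (\<lambda>k.
     \<Sum>m | (\<Sum>v\<in>UNIV. Poly_Mapping.lookup m v) \<le> k.
       F m * fps_nth (\<Prod>v\<in>UNIV. \<gamma> v ^ Poly_Mapping.lookup m v) k)"

text \<open>
  The equivalence says that substitution induces a well-defined (from right to left) and
  injective (from left to right) map on the power series ring modulo the ideal.
\<close>

definition parametrization ::
    "nat \<Rightarrow> (nat \<Rightarrow> 'v::finite mpol) \<Rightarrow> ('v \<Rightarrow> complex fps) \<Rightarrow> bool" where
  "parametrization r f \<gamma> \<longleftrightarrow>
     (\<forall>v. fps_nth (\<gamma> v) 0 = 0) \<and>
     (\<forall>F G. mps_subst \<gamma> F = mps_subst \<gamma> G \<longleftrightarrow> (\<lambda>m. F m - G m) \<in> mps_ideal_gen r f)"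

definition reparam :: "('v \<Rightarrow> complex fps) \<Rightarrow> complex fps \<Rightarrow> 'v \<Rightarrow> complex fps" where
  "reparam \<gamma> \<phi> = (\<lambda>v. fps_compose (\<gamma> v) \<phi>)"

section \<open>Rational expressions, slopes and curvatures\<close>

text \<open>A rational expression is a pair of numerator and denominator.\<close>

type_synonym 'v ratexp = "'v mpol \<times> 'v mpol"

definition rat_defined :: "('v \<Rightarrow> complex fls) \<Rightarrow> 'v ratexp \<Rightarrow> bool" where
  "rat_defined a p \<longleftrightarrow> mpol_eval fls_const a (snd p) \<noteq> 0"

definition rat_eval :: "('v \<Rightarrow> complex fls) \<Rightarrow> 'v ratexp \<Rightarrow> complex fls" where
  "rat_eval a p = mpol_eval fls_const a (fst p) / mpol_eval fls_const a (snd p)"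

text \<open>The jet variable \<open>(v, i)\<close> stands for the \<open>i\<close>-th derivative of the component \<open>v\<close>.\<close>

definition jet :: "('v \<Rightarrow> complex fps) \<Rightarrow> 'v \<times> nat \<Rightarrow> complex fls" where
  "jet \<gamma> = (\<lambda>(v, i). fps_to_fls ((fps_deriv ^^ i) (\<gamma> v)))"

definition in_derivatives :: "('v \<times> nat) ratexp \<Rightarrow> bool" where
  "in_derivatives p \<longleftrightarrow>
     (\<forall>m \<in> Poly_Mapping.keys (fst p) \<union> Poly_Mapping.keys (snd p).
        \<forall>(v, i) \<in> Poly_Mapping.keys m. i \<ge> 1)"

text \<open>\<open>curvature \<gamma> j i\<close> is \<open>\<kappa>\<^sub>i\<^sub>,\<^sub>j\<close> for \<open>i \<ge> 1\<close>; by convention \<open>curvature \<gamma> j 0\<close> is the slope \<open>s\<^sub>j\<close>.\<close>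

fun curvature :: "('n option \<Rightarrow> complex fps) \<Rightarrow> 'n \<Rightarrow> nat \<Rightarrow> complex fls" where
  "curvature \<gamma> j 0 = jet \<gamma> (Some j, 1) / jet \<gamma> (None, 1)"
| "curvature \<gamma> j (Suc 0) =
     (jet \<gamma> (Some j, 2) * jet \<gamma> (None, 1) - jet \<gamma> (Some j, 1) * jet \<gamma> (None, 2))
       / jet \<gamma> (None, 1) ^ 3"
| "curvature \<gamma> j (Suc (Suc i)) = fls_deriv (curvature \<gamma> j (Suc i)) / jet \<gamma> (None, 1)"

definition slopes_curvatures :: "('n option \<Rightarrow> complex fps) \<Rightarrow> 'n \<times> nat \<Rightarrow> complex fls" where
  "slopes_curvatures \<gamma> = (\<lambda>(j, i). curvature \<gamma> j i)"

text \<open>The values assigned to the jet variables by \<open>i\<^sub>\<kappa>\<close>; only derivatives of order \<open>i \<ge> 1\<close> matter.\<close>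

definition i_kappa :: "('n option \<Rightarrow> complex fps) \<Rightarrow> 'n option \<times> nat \<Rightarrow> complex fls" where
  "i_kappa \<gamma> = (\<lambda>(v, i). case v of
       None \<Rightarrow> if i = 1 then 1 else 0
     | Some j \<Rightarrow> curvature \<gamma> j (i - 1))"

text \<open>
  Invariance under \<open>i\<^sub>\<kappa>\<close> of an expression \<open>p = A / B\<close> defined along \<open>\<gamma>\<close>. Denominators are
  cleared because \<open>i\<^sub>\<kappa>\<close> may turn the chosen fraction into \<open>0 / 0\<close>: if \<open>R\<close> is a differential
  relation in orders at least 1 satisfied by the curve, then \<open>(x'' + R) / x''\<close> represents the invariant \<open>1\<close>
  but \<open>i\<^sub>\<kappa>\<close> annihilates both its numerator and its denominator. As \<open>B\<close> is nonzero along \<open>\<gamma>\<close>, the equation says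
  that \<open>p\<close> equals \<open>i\<^sub>\<kappa>(p)\<close> if \<open>i\<^sub>\<kappa>(B) \<noteq> 0\<close>, and otherwise that \<open>i\<^sub>\<kappa>(A) = 0\<close> too.
\<close>

definition i_kappa_invariant :: "('n option \<Rightarrow> complex fps) \<Rightarrow> ('n option \<times> nat) ratexp \<Rightarrow> bool" where
  "i_kappa_invariant \<gamma> p \<longleftrightarrow>
     mpol_eval fls_const (jet \<gamma>) (fst p) * mpol_eval fls_const (i_kappa \<gamma>) (snd p) =
     mpol_eval fls_const (i_kappa \<gamma>) (fst p) * mpol_eval fls_const (jet \<gamma>) (snd p)"

text \<open>
  The reparametrizations of \<open>\<gamma>\<close> along which \<open>p\<close> is defined. An equation
  \<open>p(t) = q(t)\<close> between rational expressions is understood to hold for the generic parametrization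
  \<open>\<gamma>\<close>, i.e. for all members of this set, as does the equivariance of \<open>p\<close>. It is not enough
  that the two series agree for one parametrization: for \<open>\<gamma> = (t, t\<^sup>2)\<close> the expression \<open>x'\<close> takes the value
  \<open>1\<close>, but it is not equivariant.
\<close>

definition reparams :: "('v \<Rightarrow> complex fps) \<Rightarrow> ('v \<times> nat) ratexp \<Rightarrow> ('v \<Rightarrow> complex fps) set" where
  "reparams \<gamma> p = {reparam \<gamma> \<phi> | \<phi>. subdegree \<phi> = 1 \<and> rat_defined (jet (reparam \<gamma> \<phi>)) p}"

definition geometric_invariant :: "('v \<Rightarrow> complex fps) \<Rightarrow> ('v \<times> nat) ratexp \<Rightarrow> bool" where
  "geometric_invariant \<gamma> p \<longleftrightarrow>
     (\<forall>\<phi>. subdegree \<phi> = 1 \<and> rat_defined (jet (reparam \<gamma> \<phi>)) p \<longrightarrow>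
        fls_compose_fps (rat_eval (jet \<gamma>) p) \<phi> = rat_eval (jet (reparam \<gamma> \<phi>)) p)"

end

(*
Write D = d/dx = (1/x') d/dt, so that D y_j = s_j and the curvatures are the iterated D-derivatives of s_j.

Invariants are functions of curvatures. Reparametrizations are flows of vector fields u d/dt with u a unit,
that is g D with g = x' u, and the iterates of g D on the coordinates are universal polynomials in the
curvatures and in g, D g, D^2 g, ... An invariant p = A / B with value p0 satisfies B (A - p0 B) = 0 for all
these g. Taking g = a_0 x' + a_1 x + ... + a_M x^M with complex a_i and a_0 nonzero, this polynomial identity
extends to all Laurent series a_i. By Hermite interpolation at the point x, the derivatives of g then
become independent variables, hence A = p0 B holds identically. The specialization g = 1 is
i_kappa, and specializing to complex numbers at which B does not vanish writes p0 in the curvatures.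

Curvatures are functions of partial derivatives. The equations f_k(gamma) = 0 differentiate to a linear system for
the slopes. Its solution is unique, so it lies in the field generated by the partial derivatives along the curve,
and this field is then closed under D.

Conversely, expressions of either kind are visibly compatible with composition.
*)
theory Submission
  imports Defs
begin

section \<open>Evaluation and differentiation of polynomials\<close>

text \<open>Two obstacles shape the argument. First, x' may vanish at the origin, as it does at a
  cusp, and g D comes from a reparametrization only if g / x' is a unit. As x is nonzero and
  vanishes at 0, the quotient x / x' is a power series vanishing at 0; hence the term a_0 x' alone
  makes g / x' a unit, whatever a_1, a_2, ... are. Secondly, equivariance says nothing about
  reparametrizations along which p is undefined. The factor B in the identity covers them; it can be
  divided out because it is nonzero for g = x', the field d/dt.

  Uniqueness for the linear system cannot be read off a rank condition on the Jacobian; it has to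
  come from the kernel of the substitution. All power series in t are finite over those in x(t), so
  each y_j satisfies a separable relation with coefficients that are power series in x. Injectivity
  puts this relation into the ideal extended to the power series ring, so that a vector annihilated
  by the equations to first order is annihilated by it too.\<close>

locale coeff_hom =
  fixes h :: "complex \<Rightarrow> 'b::comm_ring_1"
  assumes hom_0 [simp]: "h 0 = 0" and hom_1 [simp]: "h 1 = 1"
    and hom_add: "h (c + d) = h c + h d" and hom_mult: "h (c * d) = h c * h d"

interpretation fls_const: coeff_hom "fls_const :: complex \<Rightarrow> complex fls"
  by unfold_locales (auto simp: fls_plus_const fls_const_mult_const)

interpretation fps_const: coeff_hom "fps_const :: complex \<Rightarrow> complex fps"
  by unfold_locales auto

text \<open>With this structure map, evaluation substitutes polynomials for the variables.\<close>

interpretation mpol_const: coeff_hom "Poly_Mapping.single 0 :: complex \<Rightarrow> 'v mpol"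
  by unfold_locales (auto simp: single_add mult_single)

definition monom_eval :: "('v \<Rightarrow> 'b::comm_ring_1) \<Rightarrow> 'v monom \<Rightarrow> 'b" where
  "monom_eval a m = (\<Prod>v\<in>Poly_Mapping.keys m. a v ^ Poly_Mapping.lookup m v)"

lemma monom_eval_superset:
  assumes "finite S" "Poly_Mapping.keys m \<subseteq> S"
  shows "monom_eval a m = (\<Prod>v\<in>S. a v ^ Poly_Mapping.lookup m v)"
  unfolding monom_eval_def
  by (rule prod.mono_neutral_left) (use assms in \<open>auto simp: in_keys_iff\<close>)

lemma monom_eval_add: "monom_eval a (m + n) = monom_eval a m * monom_eval a n"
proof -
  let ?S = "Poly_Mapping.keys m \<union> Poly_Mapping.keys n"
  have "Poly_Mapping.keys (m + n) \<subseteq> ?S"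
    by (rule keys_add)
  then show ?thesis
    by (simp add: monom_eval_superset[of ?S] lookup_add power_add prod.distrib)
qed

lemma monom_eval_0 [simp]: "monom_eval a 0 = 1"
  by (simp add: monom_eval_def)

lemma monom_eval_single [simp]: "monom_eval a (Poly_Mapping.single v k) = a v ^ k"
  by (cases "k = 0") (simp_all add: monom_eval_def)

lemma mpol_sum_singles:
  "P = (\<Sum>m\<in>Poly_Mapping.keys P. Poly_Mapping.single m (Poly_Mapping.lookup P m))"
proof (rule poly_mapping_eqI)
  fix k
  have "(\<Sum>m\<in>Poly_Mapping.keys P. Poly_Mapping.lookup (Poly_Mapping.single m (Poly_Mapping.lookup P m)) k)
     = (\<Sum>m\<in>Poly_Mapping.keys P. if m = k then Poly_Mapping.lookup P m else 0)"
    by (rule sum.cong) (auto simp: lookup_single when_def)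
  also have "\<dots> = Poly_Mapping.lookup P k"
    by (simp add: in_keys_iff)
  finally show "Poly_Mapping.lookup P k = Poly_Mapping.lookup
      (\<Sum>m\<in>Poly_Mapping.keys P. Poly_Mapping.single m (Poly_Mapping.lookup P m)) k"
    by (simp add: lookup_sum)
qed

definition mvar :: "'v \<Rightarrow> 'v mpol" where
  "mvar v = Poly_Mapping.single (Poly_Mapping.single v 1) 1"

lemma mpol_induct_monom [case_names monom add]:
  fixes P :: "'v mpol"
  assumes "\<And>m c. R (Poly_Mapping.single m c)" and "\<And>P Q. R P \<Longrightarrow> R Q \<Longrightarrow> R (P + Q)"
  shows "R P"
proof -
  have "R (\<Sum>m\<in>S. Poly_Mapping.single m (c m))" if "finite S" for S and c :: "'v monom \<Rightarrow> complex"
    using that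
  proof (induction S rule: finite_induct)
    case empty
    show ?case using assms(1)[of 0 0] by simp
  qed (simp add: assms)
  from this[of "Poly_Mapping.keys P" "Poly_Mapping.lookup P"] show ?thesis
    using mpol_sum_singles[of P] by simp
qed

lemma mpol_induct [case_names const var add mult]:
  fixes P :: "'v mpol"
  assumes const: "\<And>c. R (Poly_Mapping.single 0 c)" and var: "\<And>v. R (mvar v)"
    and add: "\<And>P Q. R P \<Longrightarrow> R Q \<Longrightarrow> R (P + Q)" and mult: "\<And>P Q. R P \<Longrightarrow> R Q \<Longrightarrow> R (P * Q)"
  shows "R P"
proof (induction P rule: mpol_induct_monom)
  case (monom m c)
  have pow: "R (Poly_Mapping.single (Poly_Mapping.single v k) 1)" for v k
  proof (induction k)
    case 0
    show ?case using const[of 1] by simp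
  next
    case (Suc k)
    then show ?case
      using mult[OF var[of v] Suc] by (simp add: mvar_def mult_single single_add[symmetric])
  qed
  have "R (Poly_Mapping.single (\<Sum>v\<in>S. Poly_Mapping.single v (e v)) c)"
    if "finite S" for S and e :: "'v \<Rightarrow> nat"
    using that
  proof (induction S rule: finite_induct)
    case empty
    show ?case using const[of c] by simp
  next
    case (insert v S)
    then show ?case
      using mult[OF pow[of v "e v"] insert.IH] by (simp add: mult_single)
  qed
  from this[of "Poly_Mapping.keys m" "Poly_Mapping.lookup m"]
  have "R (Poly_Mapping.single (\<Sum>v\<in>Poly_Mapping.keys m. Poly_Mapping.single v (Poly_Mapping.lookup m v)) c)"
    by simp
  also have "(\<Sum>v\<in>Poly_Mapping.keys m. Poly_Mapping.single v (Poly_Mapping.lookup m v)) = m"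
  proof (rule poly_mapping_eqI)
    fix k
    have "(\<Sum>v\<in>Poly_Mapping.keys m. Poly_Mapping.lookup (Poly_Mapping.single v (Poly_Mapping.lookup m v)) k)
       = (\<Sum>v\<in>Poly_Mapping.keys m. if v = k then Poly_Mapping.lookup m v else 0)"
      by (rule sum.cong) (auto simp: lookup_single when_def)
    then show "Poly_Mapping.lookup (\<Sum>v\<in>Poly_Mapping.keys m.
        Poly_Mapping.single v (Poly_Mapping.lookup m v)) k = Poly_Mapping.lookup m k"
      by (simp add: lookup_sum in_keys_iff)
  qed
  finally show ?case .
qed (rule add)

context coeff_hom
begin

lemma mpol_eval_superset:
  assumes "finite S" "Poly_Mapping.keys P \<subseteq> S"
  shows "mpol_eval h a P = (\<Sum>m\<in>S. h (Poly_Mapping.lookup P m) * monom_eval a m)"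
  unfolding mpol_eval_def monom_eval_def
  by (rule sum.mono_neutral_left) (use assms in \<open>auto simp: in_keys_iff\<close>)

lemma mpol_eval_add [simp]: "mpol_eval h a (P + Q) = mpol_eval h a P + mpol_eval h a Q"
proof -
  let ?S = "Poly_Mapping.keys P \<union> Poly_Mapping.keys Q"
  have "Poly_Mapping.keys (P + Q) \<subseteq> ?S"
    by (rule keys_add)
  then show ?thesis
    by (simp add: mpol_eval_superset[of ?S] lookup_add hom_add algebra_simps sum.distrib)
qed

lemma mpol_eval_single: "mpol_eval h a (Poly_Mapping.single m c) = h c * monom_eval a m"
  by (simp add: mpol_eval_superset[of "{m}"])

lemma mpol_eval_const [simp]: "mpol_eval h a (Poly_Mapping.single 0 c) = h c"
  by (simp add: mpol_eval_single)

lemma mpol_eval_1 [simp]: "mpol_eval h a 1 = 1"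
  using mpol_eval_const[of a 1] by simp

lemma mpol_eval_mvar [simp]: "mpol_eval h a (mvar v) = a v"
  by (simp add: mpol_eval_single mvar_def)

lemma mpol_eval_mult [simp]: "mpol_eval h a (P * Q) = mpol_eval h a P * mpol_eval h a Q"
proof (induction P rule: mpol_induct_monom)
  case (monom m c)
  show ?case
  proof (induction Q rule: mpol_induct_monom)
    case (monom n d)
    show ?case
      by (simp add: mult_single mpol_eval_single monom_eval_add hom_mult mult_ac)
  qed (simp add: distrib_left)
qed (simp add: distrib_right)

lemma mpol_eval_0 [simp]: "mpol_eval h a 0 = 0"
  by (simp add: mpol_eval_def)

lemma mpol_eval_hom:
  assumes "\<And>x y. \<sigma> (x + y) = \<sigma> x + \<sigma> y" "\<And>x y. \<sigma> (x * y) = \<sigma> x * \<sigma> y"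
    and "coeff_hom h'" "\<And>c. \<sigma> (h c) = h' c"
  shows "\<sigma> (mpol_eval h a P) = mpol_eval h' (\<lambda>v. \<sigma> (a v)) P"
proof -
  interpret h': coeff_hom h' by fact
  show ?thesis
    by (induction P rule: mpol_induct) (simp_all add: assms)
qed

end

lemma mpol_eval_cong:
  assumes "\<And>m v. m \<in> Poly_Mapping.keys P \<Longrightarrow> v \<in> Poly_Mapping.keys m \<Longrightarrow> a v = b v"
  shows "mpol_eval h a P = mpol_eval h b P"
  unfolding mpol_eval_def using assms by (intro sum.cong prod.cong arg_cong2[of _ _ _ _ "(*)"]) auto

section \<open>Formal partial derivatives, chain rule and first-order Taylor expansion\<close>

lemma mpol_deriv_superset:
  assumes "finite S" "Poly_Mapping.keys P \<subseteq> S"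
  shows "mpol_deriv v P = (\<Sum>m\<in>S. Poly_Mapping.single (m - Poly_Mapping.single v 1)
    (of_nat (Poly_Mapping.lookup m v) * Poly_Mapping.lookup P m))"
  unfolding mpol_deriv_def
  by (rule sum.mono_neutral_left) (use assms in \<open>auto simp: in_keys_iff\<close>)

lemma mpol_deriv_add [simp]: "mpol_deriv v (P + Q) = mpol_deriv v P + mpol_deriv v Q"
proof -
  let ?S = "Poly_Mapping.keys P \<union> Poly_Mapping.keys Q"
  have "Poly_Mapping.keys (P + Q) \<subseteq> ?S"
    by (rule keys_add)
  then show ?thesis
    by (simp add: mpol_deriv_superset[of ?S] lookup_add single_add distrib_left sum.distrib)
qed

lemma mpol_deriv_single: "mpol_deriv v (Poly_Mapping.single m c) =
    Poly_Mapping.single (m - Poly_Mapping.single v 1) (of_nat (Poly_Mapping.lookup m v) * c)"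
  by (simp add: mpol_deriv_superset[of "{m}"])

lemma mpol_deriv_const [simp]: "mpol_deriv v (Poly_Mapping.single 0 c) = 0"
  by (simp add: mpol_deriv_single)

lemma mpol_deriv_mvar: "mpol_deriv v (mvar w) = (if v = w then 1 else 0)"
  by (simp add: mvar_def mpol_deriv_single lookup_single when_def)

lemma monom_minus_single_add:
  fixes m n :: "'v monom"
  assumes "Poly_Mapping.lookup m v \<noteq> 0"
  shows "m + n - Poly_Mapping.single v 1 = (m - Poly_Mapping.single v 1) + n"
  using assms
  by (intro poly_mapping_eqI) (auto simp: lookup_add lookup_minus lookup_single when_def)

lemma mpol_deriv_mult [simp]: "mpol_deriv v (P * Q) = mpol_deriv v P * Q + P * mpol_deriv v Q"
proof (induction P rule: mpol_induct_monom)
  case (monom m c)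
  show ?case
  proof (induction Q rule: mpol_induct_monom)
    case (monom n d)
    let ?e = "Poly_Mapping.single v 1 :: 'a monom"
    \<comment> \<open>Exponents are subtracted with truncation at 0. If \<open>v\<close> does not
      occur in \<open>m\<close>, the two monomials may differ, but then the coefficient is 0 on both
      sides.\<close>
    have 1: "Poly_Mapping.single (m + n - ?e) (of_nat (Poly_Mapping.lookup m v) * (c * d)) =
          Poly_Mapping.single (m - ?e + n) (of_nat (Poly_Mapping.lookup m v) * (c * d))"
      by (cases "Poly_Mapping.lookup m v = 0") (auto simp: monom_minus_single_add simp del: One_nat_def)
    have 2: "Poly_Mapping.single (m + n - ?e) (of_nat (Poly_Mapping.lookup n v) * (c * d)) =
          Poly_Mapping.single (m + (n - ?e)) (of_nat (Poly_Mapping.lookup n v) * (c * d))"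
      using monom_minus_single_add[of n v m]
      by (cases "Poly_Mapping.lookup n v = 0") (auto simp: add.commute simp del: One_nat_def)
    show ?case
      using arg_cong2[OF 1 2, of "(+)"]
      by (simp add: mult_single mpol_deriv_single lookup_add single_add[symmetric] algebra_simps)
  qed (simp add: algebra_simps)
qed (simp add: algebra_simps)

context coeff_hom
begin

lemma mpol_eval_chain_rule:
  fixes a :: "'v::finite \<Rightarrow> 'b"
  assumes "\<And>x y. d (x + y) = d x + d y" "\<And>x y. d (x * y) = x * d y + d x * y" "\<And>c. d (h c) = 0"
  shows "d (mpol_eval h a P) = (\<Sum>v\<in>UNIV. mpol_eval h a (mpol_deriv v P) * d (a v))"
proof (induction P rule: mpol_induct)
  case (var w)
  have "(\<Sum>v\<in>UNIV. mpol_eval h a (mpol_deriv v (mvar w)) * d (a v)) =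
    (\<Sum>v\<in>UNIV. if v = w then d (a v) else 0)"
    by (intro sum.cong) (auto simp: mpol_deriv_mvar)
  then show ?case by simp
qed (simp_all add: assms algebra_simps sum.distrib sum_distrib_left)

lemma mpol_eval_taylor:
  fixes a b :: "'v::finite \<Rightarrow> 'b"
  shows "\<exists>R. mpol_eval h (\<lambda>v. a v + \<epsilon> * b v) P =
    mpol_eval h a P + \<epsilon> * (\<Sum>v\<in>UNIV. mpol_eval h a (mpol_deriv v P) * b v) + \<epsilon> ^ 2 * R"
proof (induction P rule: mpol_induct)
  case (const c)
  show ?case by (intro exI[of _ 0]) simp
next
  case (var w)
  have "(\<Sum>v\<in>UNIV. mpol_eval h a (mpol_deriv v (mvar w)) * b v) =
    (\<Sum>v\<in>UNIV. if v = w then b v else 0)"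
    by (intro sum.cong) (auto simp: mpol_deriv_mvar)
  then show ?case by (intro exI[of _ 0]) simp
next
  case (add P Q)
  then obtain R S where
    "mpol_eval h (\<lambda>v. a v + \<epsilon> * b v) P =
      mpol_eval h a P + \<epsilon> * (\<Sum>v\<in>UNIV. mpol_eval h a (mpol_deriv v P) * b v) + \<epsilon> ^ 2 * R"
    "mpol_eval h (\<lambda>v. a v + \<epsilon> * b v) Q =
      mpol_eval h a Q + \<epsilon> * (\<Sum>v\<in>UNIV. mpol_eval h a (mpol_deriv v Q) * b v) + \<epsilon> ^ 2 * S"
    by blast
  then show ?case
    by (intro exI[of _ "R + S"]) (simp add: algebra_simps sum.distrib)
next
  case (mult P Q)
  define p q where "p = (\<Sum>v\<in>UNIV. mpol_eval h a (mpol_deriv v P) * b v)"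
    and "q = (\<Sum>v\<in>UNIV. mpol_eval h a (mpol_deriv v Q) * b v)"
  from mult obtain R S where
    "mpol_eval h (\<lambda>v. a v + \<epsilon> * b v) P = mpol_eval h a P + \<epsilon> * p + \<epsilon> ^ 2 * R"
    "mpol_eval h (\<lambda>v. a v + \<epsilon> * b v) Q = mpol_eval h a Q + \<epsilon> * q + \<epsilon> ^ 2 * S"
    unfolding p_def q_def by blast
  moreover have "(\<Sum>v\<in>UNIV. mpol_eval h a (mpol_deriv v (P * Q)) * b v) =
      p * mpol_eval h a Q + mpol_eval h a P * q"
    by (simp add: p_def q_def algebra_simps sum.distrib sum_distrib_left)
  ultimately show ?case
    by (intro exI[of _ "p * q + R * mpol_eval h a Q + mpol_eval h a P * S +
        \<epsilon> * (p * S + R * q) + \<epsilon> ^ 2 * (R * S)"])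
      (simp add: algebra_simps power2_eq_square)
qed

end

section \<open>Polynomial functions in countably many arguments\<close>

text \<open>Polynomial functions instead of polynomials: the coefficients are arbitrary ring
  elements, such as curvatures or the value of p, and restriction to lines and grids is direct.
  There are countably many arguments because the orders of the derivatives of g are not bounded in
  advance.\<close>

inductive polyfun :: "((nat \<Rightarrow> 'a::comm_ring_1) \<Rightarrow> 'a) \<Rightarrow> bool" where
  const: "polyfun (\<lambda>U. c)"
| var: "polyfun (\<lambda>U. U k)"
| add: "polyfun F \<Longrightarrow> polyfun G \<Longrightarrow> polyfun (\<lambda>U. F U + G U)"
| mult: "polyfun F \<Longrightarrow> polyfun G \<Longrightarrow> polyfun (\<lambda>U. F U * G U)"

lemma polyfun_diff: "polyfun F \<Longrightarrow> polyfun G \<Longrightarrow> polyfun (\<lambda>U. F U - G U)"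
  using polyfun.add[OF _ polyfun.mult[OF polyfun.const[of "-1"]], of F G] by simp

lemma polyfun_sum: "(\<And>i. i \<in> I \<Longrightarrow> polyfun (F i)) \<Longrightarrow> polyfun (\<lambda>U. \<Sum>i\<in>I. F i U)"
  by (induction I rule: infinite_finite_induct) (auto intro: polyfun.intros)

lemma polyfun_compose:
  assumes "polyfun F" and "\<And>k. polyfun (\<lambda>a. L a k)"
  shows "polyfun (\<lambda>a. F (L a))"
  using assms(1) by induction (auto intro: polyfun.intros assms(2))

lemma polyfun_line: "polyfun F \<Longrightarrow> \<exists>P. \<forall>s. F (\<lambda>i. U i + s * V i) = poly P s"
proof (induction rule: polyfun.induct)
  case (const c)
  show ?case by (rule exI[of _ "[:c:]"]) simp
next
  case (var k)
  show ?case by (rule exI[of _ "[:U k, V k:]"]) simp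
next
  case (add F G)
  then show ?case by (metis poly_add)
next
  case (mult F G)
  then show ?case by (metis poly_mult)
qed

lemma polyfun_finitely_many_args:
  "polyfun F \<Longrightarrow> \<exists>N. \<forall>U V. (\<forall>i<N. U i = V i) \<longrightarrow> F U = F V"
proof (induction rule: polyfun.induct)
  case (var k)
  show ?case by (rule exI[of _ "Suc k"]) auto
next
  case (add F G)
  then obtain N M where "\<And>U V. (\<forall>i<N. U i = V i) \<Longrightarrow> F U = F V"
    "\<And>U V. (\<forall>i<M. U i = V i) \<Longrightarrow> G U = G V" by blast
  then have "\<forall>U V. (\<forall>i<max N M. U i = V i) \<longrightarrow> F U + G U = F V + G V"
    by (metis less_max_iff_disj)
  then show ?case by blast
next
  case (mult F G)
  then obtain N M where "\<And>U V. (\<forall>i<N. U i = V i) \<Longrightarrow> F U = F V"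
    "\<And>U V. (\<forall>i<M. U i = V i) \<Longrightarrow> G U = G V" by blast
  then have "\<forall>U V. (\<forall>i<max N M. U i = V i) \<longrightarrow> F U * G U = F V * G V"
    by (metis less_max_iff_disj)
  then show ?case by blast
qed auto

lemma poly_eq_0_if_infinite_roots:
  fixes P :: "'a::idom poly"
  assumes "infinite S" "\<And>s. s \<in> S \<Longrightarrow> poly P s = 0"
  shows "P = 0"
proof (rule ccontr)
  assume "P \<noteq> 0"
  then have "finite {s. poly P s = 0}" by (rule poly_roots_finite)
  moreover have "S \<subseteq> {s. poly P s = 0}" using assms(2) by auto
  ultimately show False using assms(1) finite_subset by blast
qed

text \<open>Applied with sides \<open>S i\<close> consisting of constant Laurent series: an identity
  checked for complex arguments then holds for all Laurent series.\<close>

lemma polyfun_eq_0: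
  fixes F :: "(nat \<Rightarrow> 'a::idom) \<Rightarrow> 'a"
  assumes F: "polyfun F" and S: "\<And>i. infinite (S i)"
    and zero: "\<And>U. (\<And>i. U i \<in> S i) \<Longrightarrow> F U = 0"
  shows "F U = 0"
proof -
  obtain N where N: "\<And>U V. (\<forall>i<N. U i = V i) \<Longrightarrow> F U = F V"
    using polyfun_finitely_many_args[OF F] by blast
  \<comment> \<open>\<open>n\<close> counts the arguments that may leave the grid; freeing one more
    uses that a univariate polynomial with infinitely many roots is zero.\<close>
  have step: "F U = 0" if "\<And>i. i \<ge> n \<Longrightarrow> U i \<in> S i" for n U
    using that
  proof (induction n arbitrary: U)
    case 0
    then show ?case by (simp add: zero)
  next
    case (Suc n)
    obtain P where P: "\<And>s. F (\<lambda>i. (U(n := 0)) i + s * ((\<lambda>_. 0)(n := 1)) i) = poly P s"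
      using polyfun_line[OF F] by blast
    moreover have "(\<lambda>i. (U(n := 0)) i + s * ((\<lambda>_. 0)(n := 1)) i) = U(n := s)" for s
      by auto
    ultimately have P: "F (U(n := s)) = poly P s" for s
      by metis
    have "poly P s = 0" if "s \<in> S n" for s
      unfolding P[symmetric] using Suc.prems that by (intro Suc.IH) auto
    then have "P = 0" by (rule poly_eq_0_if_infinite_roots[OF S])
    then show ?case using P[of "U n"] by simp
  qed
  have "\<exists>s. s \<in> S i" for i
    using S[of i] by (metis finite.emptyI all_not_in_conv)
  then obtain e where e: "\<And>i. e i \<in> S i" by metis
  \<comment> \<open>Only the first \<open>N\<close> arguments matter, so the others are moved into
    the grid.\<close>
  have "F U = F (\<lambda>i. if i < N then U i else e i)"
    by (rule N) auto
  also have "\<dots> = 0"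
    by (rule step[of N]) (auto simp: e)
  finally show ?thesis .
qed

text \<open>On the line through \<open>V\<close> (parameter 0) and \<open>U\<close> (parameter 1)
  both functions are univariate polynomials, the first nonzero at 0. Their product vanishes at all
  points of the line, infinitely many in characteristic 0.\<close>

lemma polyfun_mult_eq_0:
  fixes F :: "(nat \<Rightarrow> 'a::{idom,ring_char_0}) \<Rightarrow> 'a"
  assumes "polyfun F" "polyfun G" "\<And>U. F U * G U = 0" "F V \<noteq> 0"
  shows "G U = 0"
proof -
  obtain P where P: "\<And>s. F (\<lambda>i. V i + s * (U i - V i)) = poly P s"
    using polyfun_line[OF assms(1), of V "\<lambda>i. U i - V i"] by blast
  obtain Q where Q: "\<And>s. G (\<lambda>i. V i + s * (U i - V i)) = poly Q s"
    using polyfun_line[OF assms(2), of V "\<lambda>i. U i - V i"] by blast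
  have "poly (P * Q) s = 0" for s
    using assms(3) by (simp flip: P Q)
  then have "P * Q = 0"
    by (intro poly_eq_0_if_infinite_roots[of UNIV]) (auto simp: infinite_UNIV_char_0)
  moreover have "P \<noteq> 0"
    using assms(4) P[of 0] by auto
  ultimately have "Q = 0" by simp
  then show ?thesis using Q[of 1] by simp
qed

lemma (in coeff_hom) polyfun_mpol_eval:
  assumes "\<And>v. polyfun (\<lambda>U. a U v)"
  shows "polyfun (\<lambda>U. mpol_eval h (a U) P)"
  by (induction P rule: mpol_induct) (auto intro: polyfun.intros assms)

section \<open>Hermite interpolation at a single point\<close>

lemma higher_pderiv_linear_power:
  fixes x :: "'a::field_char_0"
  assumes "k \<le> m"
  shows "\<exists>c\<noteq>0. (pderiv ^^ k) ([:-x, 1:] ^ m) = smult c ([:-x, 1:] ^ (m - k))"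
  using assms
proof (induction k)
  case 0
  show ?case by (rule exI[of _ 1]) simp
next
  case (Suc k)
  then obtain c where c: "c \<noteq> 0" "(pderiv ^^ k) ([:-x, 1:] ^ m) = smult c ([:-x, 1:] ^ (m - k))"
    by auto
  obtain l where l: "m - k = Suc l" using Suc.prems by (metis Suc_diff_Suc Suc_le_lessD)
  have "(pderiv ^^ Suc k) ([:-x, 1:] ^ m) = smult (c * of_nat (Suc l)) ([:-x, 1:] ^ l)"
    by (simp add: c(2) l pderiv_smult pderiv_power_Suc pderiv_pCons del: power_Suc of_nat_Suc)
  moreover have "l = m - Suc k" using l by simp
  moreover have "c * of_nat (Suc l) \<noteq> 0" using c(1) by (simp del: of_nat_Suc)
  ultimately show ?case by blast
qed

lemma higher_pderiv_add: "(pderiv ^^ k) (P + Q) = (pderiv ^^ k) P + (pderiv ^^ k) Q"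
  by (induction k) (simp_all add: pderiv_add)

lemma higher_pderiv_smult: "(pderiv ^^ k) (smult c P) = smult c ((pderiv ^^ k) P)"
  by (induction k) (simp_all add: pderiv_smult)

lemma higher_pderiv_sum: "(pderiv ^^ k) (sum P S) = (\<Sum>i\<in>S. (pderiv ^^ k) (P i))"
proof -
  have "(pderiv ^^ k) 0 = (0 :: 'a poly)" by (induction k) simp_all
  then show ?thesis
    by (induction S rule: infinite_finite_induct) (simp_all add: higher_pderiv_add)
qed

text \<open>The condition on \<open>coeff P 0\<close> is there because the fields used later combine
  x', x, x^2, ... without a constant term; it costs one degree.\<close>

lemma poly_with_prescribed_derivatives:
  fixes x :: "'a::field_char_0"
  assumes "x \<noteq> 0"
  shows "\<exists>P. degree P \<le> Suc N \<and> coeff P 0 = 0 \<and> (\<forall>k\<le>N. poly ((pderiv ^^ k) P) x = U k)"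
proof -
  let ?q = "[:-x, 1:]"
  have below: "poly ((pderiv ^^ k) (?q ^ m)) x = 0" if "k < m" for k m
    using higher_pderiv_linear_power[of k m x] that by (auto simp: zero_power)
  have deg: "degree (smult c (?q ^ m)) \<le> m" for c m
    by (rule order_trans[OF degree_smult_le]) (simp add: degree_linear_power)
  have "\<exists>P. degree P \<le> N \<and> (\<forall>k\<le>N. poly ((pderiv ^^ k) P) x = U k)"
  proof (induction N)
    case 0
    show ?case by (rule exI[of _ "[:U 0:]"]) simp
  next
    case (Suc N)
    then obtain P where P: "degree P \<le> N" "\<And>k. k \<le> N \<Longrightarrow> poly ((pderiv ^^ k) P) x = U k" by blast
    \<comment> \<open>The power (X - x)^(N+1) has vanishing derivatives at x below order N+1, and
      its derivative of that order is the nonzero constant \<open>c\<close>. Adding a multiple of it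
      adjusts the new value and none of the earlier ones.\<close>
    obtain c where c: "c \<noteq> 0" "(pderiv ^^ Suc N) (?q ^ Suc N) = smult c (?q ^ (Suc N - Suc N))"
      using higher_pderiv_linear_power[of "Suc N" "Suc N" x] by blast
    define b where "b = (U (Suc N) - poly ((pderiv ^^ Suc N) P) x) / c"
    let ?P = "P + smult b (?q ^ Suc N)"
    have "poly ((pderiv ^^ k) ?P) x = U k" if "k \<le> Suc N" for k
    proof (cases "k = Suc N")
      case True
      then show ?thesis using c
        by (simp add: higher_pderiv_add higher_pderiv_smult b_def del: funpow.simps power_Suc)
    next
      case False
      then show ?thesis using P(2)[of k] below[of k "Suc N"] that
        by (simp add: higher_pderiv_add higher_pderiv_smult del: funpow.simps power_Suc)
    qed
    moreover have "degree ?P \<le> Suc N"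
      using P(1) deg[of b "Suc N"] by (intro degree_add_le) (auto simp del: power_Suc)
    ultimately show ?case by blast
  qed
  then obtain P where P: "degree P \<le> N" "\<And>k. k \<le> N \<Longrightarrow> poly ((pderiv ^^ k) P) x = U k" by blast
  \<comment> \<open>The same power does not affect the derivatives up to order N at x. Its value at
    0 is nonzero, so it can cancel the constant coefficient.\<close>
  define b where "b = - poly P 0 / (- x) ^ Suc N"
  let ?P = "P + smult b (?q ^ Suc N)"
  have "poly ?P 0 = 0"
    using assms by (simp add: b_def del: power_Suc)
  then have "coeff ?P 0 = 0" by (simp only: poly_0_coeff_0)
  moreover have "degree ?P \<le> Suc N"
    using P(1) deg[of b "Suc N"] by (intro degree_add_le) (auto simp del: power_Suc)
  moreover have "poly ((pderiv ^^ k) ?P) x = U k" if "k \<le> N" for k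
    using P(2)[OF that] below[of k "Suc N"] that
    by (simp add: higher_pderiv_add higher_pderiv_smult del: power_Suc)
  ultimately show ?thesis by blast
qed

section \<open>Composition and derivations of Laurent series\<close>

lemma fls_deriv_divide:
  fixes a b :: "'a::field fls"
  assumes "b \<noteq> 0"
  shows "fls_deriv (a / b) = (fls_deriv a * b - a * fls_deriv b) / b ^ 2"
proof -
  have "fls_deriv a = fls_deriv (a / b * b)" using assms by simp
  also have "\<dots> = a / b * fls_deriv b + fls_deriv (a / b) * b" by (simp only: fls_deriv_mult)
  finally show ?thesis using assms by (simp add: field_simps power2_eq_square)
qed

lemma fls_as_quotient:
  fixes F :: "'a::field fls"
  obtains f n where "F = fps_to_fls f / fls_X ^ n"
proof
  have "F = fls_shift (int (nat (- fls_subdegree F))) (fps_to_fls (fls_regpart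
      (fls_shift (- int (nat (- fls_subdegree F))) F)))"
    by (intro fls_eqI) auto
  then show "F = fps_to_fls (fls_regpart (fls_shift (- int (nat (- fls_subdegree F))) F)) /
      fls_X ^ nat (- fls_subdegree F)"
    by simp
qed

text \<open>Writing F = f / X^n reduces the chain rule to the one for power series and the quotient
  rule.\<close>

lemma fls_deriv_compose_fps:
  fixes F :: "'a::field_char_0 fls"
  assumes [simp]: "H \<noteq> 0" "fps_nth H 0 = 0"
  shows "fls_deriv (fls_compose_fps F H) = fls_compose_fps (fls_deriv F) H * fps_to_fls (fps_deriv H)"
proof -
  obtain f n where F: "F = fps_to_fls f / fls_X ^ n" by (rule fls_as_quotient)
  have *: "fls_deriv (fls_compose_fps (fps_to_fls g) H) =
      fls_compose_fps (fls_deriv (fps_to_fls g)) H * fps_to_fls (fps_deriv H)" for g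
    by (simp add: fls_deriv_fps_to_fls fps_compose_deriv fls_times_fps_to_fls)
  have X: "fls_X ^ n = fps_to_fls (fps_X ^ n :: 'a fps)"
    by (simp add: fps_to_fls_power)
  have nz: "fls_compose_fps (fps_to_fls (fps_X ^ n)) H \<noteq> 0"
    by (simp add: fps_compose_power[symmetric])
  show ?thesis
    unfolding F X
    by (subst fls_deriv_divide, simp, subst fls_compose_fps_divide, simp, simp,
        subst fls_deriv_divide[OF nz])
      (simp only: * fls_compose_fps_divide assms fls_compose_fps_diff fls_compose_fps_mult
        fls_compose_fps_power simp_thms, simp add: algebra_simps diff_divide_distrib)
qed

section \<open>The action of reparametrizations on jets and curvatures\<close>

lemma subdegree_1_iff: "subdegree (\<phi> :: 'a::zero fps) = 1 \<longleftrightarrow> fps_nth \<phi> 0 = 0 \<and> fps_nth \<phi> 1 \<noteq> 0"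
proof
  assume "subdegree \<phi> = 1"
  then show "fps_nth \<phi> 0 = 0 \<and> fps_nth \<phi> 1 \<noteq> 0"
    using nth_subdegree_nonzero[of \<phi>] nth_less_subdegree_zero[of 0 \<phi>] by (cases "\<phi> = 0") auto
next
  assume "fps_nth \<phi> 0 = 0 \<and> fps_nth \<phi> 1 \<noteq> 0"
  then show "subdegree \<phi> = 1" by (intro subdegreeI) auto
qed

lemma subdegree_1D:
  assumes "subdegree (\<phi> :: 'a::zero fps) = 1"
  shows "\<phi> \<noteq> 0" "fps_nth \<phi> 0 = 0" "fps_nth \<phi> 1 \<noteq> 0"
  using assms subdegree_1_iff[of \<phi>] by auto

lemma fls_compose_mpol_eval:
  assumes "subdegree \<phi> = 1"
  shows "fls_compose_fps (mpol_eval fls_const a P) \<phi> =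
    mpol_eval fls_const (\<lambda>v. fls_compose_fps (a v) \<phi>) P"
proof -
  note \<phi>0 = subdegree_1D[OF assms]
  from \<phi>0 show ?thesis
    by (intro fls_const.mpol_eval_hom)
      (simp_all add: fls_compose_fps_add fls_compose_fps_mult fls_const.coeff_hom_axioms)
qed

lemma fls_compose_rat_eval:
  assumes "subdegree \<phi> = 1"
  shows "fls_compose_fps (rat_eval a p) \<phi> = rat_eval (\<lambda>v. fls_compose_fps (a v) \<phi>) p"
proof -
  note \<phi>0 = subdegree_1D[OF assms]
  from \<phi>0 show ?thesis
    by (simp add: rat_eval_def fls_compose_fps_divide fls_compose_mpol_eval[OF assms])
qed

lemma reparam_X [simp]: "reparam \<gamma> fps_X = \<gamma>"
  by (simp add: reparam_def)

text \<open>Reparametrizations are the flows \<open>\<phi>' = u \<circ> \<phi>\<close>: \<open>\<phi>\<close> is inverse to an antiderivative of \<open>1 / u\<close>.\<close>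

lemma ex_reparam_flow:
  fixes u :: "complex fps"
  assumes "fps_nth u 0 \<noteq> 0"
  shows "\<exists>\<phi>. subdegree \<phi> = 1 \<and> fps_deriv \<phi> = u oo \<phi>"
proof -
  define \<psi> where "\<psi> = fps_integral0 (inverse u)"
  have \<psi>: "fps_nth \<psi> 0 = 0" "fps_nth \<psi> 1 \<noteq> 0" "fps_deriv \<psi> = inverse u"
    using assms by (simp_all add: \<psi>_def fps_deriv_fps_integral)
  let ?\<phi> = "fps_inv \<psi>"
  have [simp]: "fps_nth ?\<phi> 0 = 0" by (simp add: fps_inv_def)
  have deriv: "fps_deriv ?\<phi> = u oo ?\<phi>"
    using fps_inv_deriv[OF \<psi>(1,2)] assms by (simp add: \<psi>(3) fps_inverse_compose)
  have "fps_nth ?\<phi> 1 = fps_nth (fps_deriv ?\<phi>) 0" by simp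
  also have "\<dots> = fps_nth u 0" by (simp only: deriv fps_compose_nth_0)
  finally show ?thesis using assms deriv by (metis \<open>fps_nth ?\<phi> 0 = 0\<close> subdegree_1_iff)
qed

lemma jet_Suc: "jet \<gamma> (v, Suc i) = fls_deriv (jet \<gamma> (v, i))"
  by (simp add: jet_def fls_deriv_fps_to_fls)

text \<open>The flow equation turns d/dt of h o \<open>\<phi>\<close> into (u h') o
  \<open>\<phi>\<close>, so the derivatives of the reparametrized curve are the iterates of u d/dt
  on the coordinates, composed with \<open>\<phi>\<close>.\<close>

lemma jet_reparam_flow:
  assumes "subdegree \<phi> = 1" "fps_deriv \<phi> = u oo \<phi>"
  shows "jet (reparam \<gamma> \<phi>) (v, i) =
    fls_compose_fps (((\<lambda>h. fps_to_fls u * fls_deriv h) ^^ i) (fps_to_fls (\<gamma> v))) \<phi>"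
proof (induction i)
  case 0
  show ?case using subdegree_1D[OF assms(1)] by (simp add: jet_def reparam_def)
next
  case (Suc i)
  note subdegree_1D[OF assms(1)]
  then show ?case
    by (simp add: jet_Suc Suc fls_deriv_compose_fps assms(2) fls_compose_fps_mult)
qed

section \<open>The derivation d/dx and the recursion for the curvatures\<close>

definition x_deriv :: "('n option \<Rightarrow> complex fps) \<Rightarrow> complex fls \<Rightarrow> complex fls" where
  "x_deriv \<gamma> h = fls_deriv h / jet \<gamma> (None, 1)"

lemma x_deriv_add [simp]: "x_deriv \<gamma> (g + h) = x_deriv \<gamma> g + x_deriv \<gamma> h"
  and x_deriv_mult [simp]: "x_deriv \<gamma> (g * h) = g * x_deriv \<gamma> h + x_deriv \<gamma> g * h"
  and x_deriv_const [simp]: "x_deriv \<gamma> (fls_const c) = 0"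
  and x_deriv_0 [simp]: "x_deriv \<gamma> 0 = 0"
  and x_deriv_1 [simp]: "x_deriv \<gamma> 1 = 0"
  by (simp_all add: x_deriv_def add_divide_distrib)

lemma x_deriv_sum: "x_deriv \<gamma> (\<Sum>i\<in>I. g i) = (\<Sum>i\<in>I. x_deriv \<gamma> (g i))"
  by (induction I rule: infinite_finite_induct) simp_all

lemma jet_None_nonzero: "fps_deriv (\<gamma> None) \<noteq> 0 \<Longrightarrow> jet \<gamma> (None, 1) \<noteq> 0"
  by (simp add: jet_def)

lemma x_deriv_x:
  assumes "fps_deriv (\<gamma> None) \<noteq> 0"
  shows "x_deriv \<gamma> (fps_to_fls (\<gamma> None)) = 1"
  using assms by (simp add: x_deriv_def jet_def fls_deriv_fps_to_fls)

lemma x_deriv_y: "x_deriv \<gamma> (fps_to_fls (\<gamma> (Some j))) = curvature \<gamma> j 0"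
  by (simp add: x_deriv_def jet_def fls_deriv_fps_to_fls)

text \<open>For \<open>i = 0\<close> this is the quotient rule, which accounts for the cube of x' in
  the definition; the slopes and all curvatures thus obey one uniform recursion.\<close>

lemma curvature_Suc:
  assumes "fps_deriv (\<gamma> None) \<noteq> 0"
  shows "curvature \<gamma> j (Suc i) = x_deriv \<gamma> (curvature \<gamma> j i)"
proof (cases i)
  case 0
  note nz = jet_None_nonzero[where \<gamma> = \<gamma>, OF assms]
  show ?thesis
    unfolding 0 x_deriv_def curvature.simps
    by (subst fls_deriv_divide[OF nz])
      (simp add: jet_Suc[symmetric] numeral_2_eq_2 numeral_3_eq_3)
next
  case (Suc k)
  then show ?thesis by (simp add: x_deriv_def)
qed

declare curvature.simps [simp del]

lemma fps_deriv_reparam: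
  assumes "subdegree \<phi> = 1"
  shows "fps_deriv (reparam \<gamma> \<phi> v) = (fps_deriv (\<gamma> v) oo \<phi>) * fps_deriv \<phi>"
  using subdegree_1D[OF assms] by (simp add: reparam_def fps_compose_deriv)

lemma fps_deriv_reparam_nonzero:
  assumes "subdegree \<phi> = 1" "fps_deriv (\<gamma> v) \<noteq> 0"
  shows "fps_deriv (reparam \<gamma> \<phi> v) \<noteq> 0"
proof -
  have "fps_nth (fps_deriv \<phi>) 0 \<noteq> 0" using subdegree_1D[OF assms(1)] by simp
  then have "fps_deriv \<phi> \<noteq> 0" by (metis fps_zero_nth)
  moreover have "fps_deriv (\<gamma> v) oo \<phi> \<noteq> 0"
    using subdegree_1D[OF assms(1)] assms(2) by (simp add: fps_compose_eq_0_iff)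
  ultimately show ?thesis by (simp add: fps_deriv_reparam[OF assms(1)])
qed

text \<open>The factor \<open>\<phi>'\<close> from the chain rule cancels against the one in the
  derivative of x o \<open>\<phi>\<close>, so D commutes with composition by
  \<open>\<phi>\<close>.\<close>

lemma curvature_reparam:
  assumes \<phi>: "subdegree \<phi> = 1" and x: "fps_deriv (\<gamma> None) \<noteq> 0"
  shows "curvature (reparam \<gamma> \<phi>) j i = fls_compose_fps (curvature \<gamma> j i) \<phi>"
proof -
  note \<phi>0 = subdegree_1D[OF \<phi>]
  then have "fps_nth (fps_deriv \<phi>) 0 \<noteq> 0" by simp
  then have \<phi>': "fps_deriv \<phi> \<noteq> 0" by (metis fps_zero_nth)
  have jet: "jet (reparam \<gamma> \<phi>) (v, 1) = fls_compose_fps (jet \<gamma> (v, 1)) \<phi> * fps_to_fls (fps_deriv \<phi>)" for v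
    using \<phi>0 by (simp add: jet_def fps_deriv_reparam[OF \<phi>] fls_times_fps_to_fls)
  have D: "x_deriv (reparam \<gamma> \<phi>) (fls_compose_fps h \<phi>) = fls_compose_fps (x_deriv \<gamma> h) \<phi>" for h
    using \<phi>0 \<phi>' by (simp add: x_deriv_def jet[unfolded One_nat_def] fls_deriv_compose_fps fls_compose_fps_divide)
  show ?thesis
  proof (induction i)
    case 0
    show ?case
      using \<phi>0 \<phi>' by (simp add: curvature.simps jet[unfolded One_nat_def] fls_compose_fps_divide)
  next
    case (Suc i)
    then show ?case
      by (simp only: curvature_Suc[where \<gamma> = \<gamma>, OF x] curvature_Suc[where \<gamma> = "reparam \<gamma> \<phi>", OF fps_deriv_reparam_nonzero[where \<gamma> = \<gamma>, OF \<phi> x]] D)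
  qed
qed

section \<open>Invariants as functions of slopes and curvatures\<close>

text \<open>
  Along the curve, the vector field \<open>g D\<close> with \<open>D = d/dx\<close> has \<open>i\<close>-th iterates on the coordinates
  which are universal polynomials in the curvatures (variables \<open>Inl\<close>) and in the derivatives
  \<open>g, D g, D\<^sup>2 g, \<dots>\<close> (variables \<open>Inr\<close>).
\<close>

definition field_jet :: "('n option \<Rightarrow> complex fps) \<Rightarrow> (nat \<Rightarrow> complex fls) \<Rightarrow> ('n \<times> nat) + nat \<Rightarrow> complex fls" where
  "field_jet \<gamma> U = case_sum (slopes_curvatures \<gamma>) U"

lemma field_jet_Inl [simp]: "field_jet \<gamma> U (Inl (j, i)) = curvature \<gamma> j i"
  and field_jet_Inr [simp]: "field_jet \<gamma> U (Inr k) = U k"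
  by (simp_all add: field_jet_def slopes_curvatures_def)

text \<open>D raises the index of a curvature and of a derivative of g by one, so by the Leibniz
  rule it acts on polynomials in these variables. The order of the quantifiers matters:
  \<open>P'\<close> does not depend on \<open>g\<close>.\<close>

lemma ex_formal_derivative:
  assumes x: "fps_deriv (\<gamma> None) \<noteq> 0"
  shows "\<exists>P'. \<forall>g. x_deriv \<gamma> (mpol_eval fls_const (field_jet \<gamma> (\<lambda>k. (x_deriv \<gamma> ^^ k) g)) P) =
    mpol_eval fls_const (field_jet \<gamma> (\<lambda>k. (x_deriv \<gamma> ^^ k) g)) P'"
proof (induction P rule: mpol_induct)
  case (const c)
  show ?case by (rule exI[of _ 0]) simp
next
  case (var w)
  show ?case
  proof (cases w)
    case (Inl ji)
    obtain j i where ji: "ji = (j, i)" by fastforce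
    show ?thesis
      by (rule exI[of _ "mvar (Inl (j, Suc i))"])
        (simp add: Inl ji curvature_Suc[where \<gamma> = \<gamma>, OF x])
  next
    case (Inr k)
    show ?thesis
      by (rule exI[of _ "mvar (Inr (Suc k))"]) (simp add: Inr)
  qed
next
  case (add P Q)
  then obtain P' Q' where "\<forall>g. x_deriv \<gamma> (mpol_eval fls_const (field_jet \<gamma> (\<lambda>k. (x_deriv \<gamma> ^^ k) g)) P) =
    mpol_eval fls_const (field_jet \<gamma> (\<lambda>k. (x_deriv \<gamma> ^^ k) g)) P'"
    "\<forall>g. x_deriv \<gamma> (mpol_eval fls_const (field_jet \<gamma> (\<lambda>k. (x_deriv \<gamma> ^^ k) g)) Q) =
    mpol_eval fls_const (field_jet \<gamma> (\<lambda>k. (x_deriv \<gamma> ^^ k) g)) Q'" by blast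
  then show ?case by (intro exI[of _ "P' + Q'"]) simp
next
  case (mult P Q)
  then obtain P' Q' where "\<forall>g. x_deriv \<gamma> (mpol_eval fls_const (field_jet \<gamma> (\<lambda>k. (x_deriv \<gamma> ^^ k) g)) P) =
    mpol_eval fls_const (field_jet \<gamma> (\<lambda>k. (x_deriv \<gamma> ^^ k) g)) P'"
    "\<forall>g. x_deriv \<gamma> (mpol_eval fls_const (field_jet \<gamma> (\<lambda>k. (x_deriv \<gamma> ^^ k) g)) Q) =
    mpol_eval fls_const (field_jet \<gamma> (\<lambda>k. (x_deriv \<gamma> ^^ k) g)) Q'" by blast
  then show ?case by (intro exI[of _ "P * Q' + P' * Q"]) simp
qed

text \<open>The iteration starts at order 1, where (g D) x = g and (g D) y_j = g s_j are polynomials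
  in the variables; the coordinates themselves are not among these variables.\<close>

lemma ex_universal_jet:
  assumes x: "fps_deriv (\<gamma> None) \<noteq> 0" and "i \<ge> 1"
  shows "\<exists>T. \<forall>g. mpol_eval fls_const (field_jet \<gamma> (\<lambda>k. (x_deriv \<gamma> ^^ k) g)) T =
    ((\<lambda>h. g * x_deriv \<gamma> h) ^^ i) (fps_to_fls (\<gamma> v))"
  using assms(2)
proof (induction i rule: dec_induct)
  case base
  show ?case
  proof (cases v)
    case None
    then show ?thesis
      by (intro exI[of _ "mvar (Inr 0)"]) (simp add: x_deriv_x[where \<gamma> = \<gamma>, OF x])
  next
    case (Some j)
    then show ?thesis
      by (intro exI[of _ "mvar (Inr 0) * mvar (Inl (j, 0))"])
        (simp add: x_deriv_y)
  qed
next
  case (step i)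
  then obtain T where T: "\<forall>g. mpol_eval fls_const (field_jet \<gamma> (\<lambda>k. (x_deriv \<gamma> ^^ k) g)) T =
    ((\<lambda>h. g * x_deriv \<gamma> h) ^^ i) (fps_to_fls (\<gamma> v))" by blast
  obtain T' where T': "\<forall>g. x_deriv \<gamma> (mpol_eval fls_const (field_jet \<gamma> (\<lambda>k. (x_deriv \<gamma> ^^ k) g)) T) =
    mpol_eval fls_const (field_jet \<gamma> (\<lambda>k. (x_deriv \<gamma> ^^ k) g)) T'"
    using ex_formal_derivative[where \<gamma> = \<gamma>, OF x] by blast
  show ?case
    by (rule exI[of _ "mvar (Inr 0) * T'"])
      (simp add: T'[rule_format, symmetric] T)
qed

lemma x_deriv_iterated_y:
  assumes "fps_deriv (\<gamma> None) \<noteq> 0"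
  shows "(x_deriv \<gamma> ^^ Suc i) (fps_to_fls (\<gamma> (Some j))) = curvature \<gamma> j i"
proof (induction i)
  case 0
  show ?case by (simp add: x_deriv_y)
next
  case (Suc i)
  have "(x_deriv \<gamma> ^^ Suc (Suc i)) (fps_to_fls (\<gamma> (Some j))) =
      x_deriv \<gamma> ((x_deriv \<gamma> ^^ Suc i) (fps_to_fls (\<gamma> (Some j))))"
    by (simp only: funpow.simps o_apply)
  then show ?case by (simp only: Suc curvature_Suc[where \<gamma> = \<gamma>, OF assms])
qed

lemma x_deriv_iterated_0 [simp]: "(x_deriv \<gamma> ^^ k) 0 = 0"
  by (induction k) simp_all

lemma x_deriv_iterated_1: "(x_deriv \<gamma> ^^ k) 1 = (if k = 0 then 1 else 0)"
  by (cases k) (simp_all add: funpow_Suc_right del: funpow.simps(2))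

text \<open>Substituting \<open>i_kappa\<close> amounts to using x itself as the parameter: D x = 1
  with vanishing higher derivatives, and D^i y_j is the curvature of index i - 1.\<close>

lemma i_kappa_eq_iterated_x_deriv:
  assumes x: "fps_deriv (\<gamma> None) \<noteq> 0" and "i \<ge> 1"
  shows "i_kappa \<gamma> (v, i) = (x_deriv \<gamma> ^^ i) (fps_to_fls (\<gamma> v))"
proof -
  obtain k where k: "i = Suc k" using assms(2) by (cases i) auto
  show ?thesis
  proof (cases v)
    case None
    have "(x_deriv \<gamma> ^^ i) (fps_to_fls (\<gamma> v)) = (x_deriv \<gamma> ^^ k) 1"
      by (simp add: k None funpow_Suc_right x_deriv_x[where \<gamma> = \<gamma>, OF x] del: funpow.simps(2))
    then show ?thesis by (simp add: None k i_kappa_def x_deriv_iterated_1)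
  next
    case (Some j)
    then show ?thesis by (simp only: k x_deriv_iterated_y[where \<gamma> = \<gamma>, OF x]) (simp add: i_kappa_def)
  qed
qed

lemma i_kappa_reparam:
  assumes \<phi>: "subdegree \<phi> = 1" and x: "fps_deriv (\<gamma> None) \<noteq> 0"
  shows "i_kappa (reparam \<gamma> \<phi>) w = fls_compose_fps (i_kappa \<gamma> w) \<phi>"
  by (auto simp: i_kappa_def curvature_reparam[where \<gamma> = \<gamma>, OF \<phi> x] split: prod.split option.split)

lemma slopes_curvatures_reparam:
  assumes \<phi>: "subdegree \<phi> = 1" and x: "fps_deriv (\<gamma> None) \<noteq> 0"
  shows "slopes_curvatures (reparam \<gamma> \<phi>) w = fls_compose_fps (slopes_curvatures \<gamma> w) \<phi>"
  by (auto simp: slopes_curvatures_def curvature_reparam[where \<gamma> = \<gamma>, OF \<phi> x] split: prod.split)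

lemma x_deriv_poly:
  assumes x: "fps_deriv (\<gamma> None) \<noteq> 0"
    and "\<And>i. x_deriv \<gamma> (coeff P i) = 0"
  shows "x_deriv \<gamma> (poly P (fps_to_fls (\<gamma> None))) = poly (pderiv P) (fps_to_fls (\<gamma> None))"
  using assms(2)
proof (induction P)
  case (pCons a P)
  have "x_deriv \<gamma> a = 0" using pCons.prems[of 0] by simp
  moreover have "x_deriv \<gamma> (coeff P i) = 0" for i using pCons.prems[of "Suc i"] by simp
  ultimately show ?case
    using pCons.IH by (simp add: x_deriv_x[where \<gamma> = \<gamma>, OF x] pderiv_pCons)
qed simp

lemma x_deriv_iterated_poly:
  assumes x: "fps_deriv (\<gamma> None) \<noteq> 0"
    and "\<And>i. x_deriv \<gamma> (coeff P i) = 0"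
  shows "(x_deriv \<gamma> ^^ k) (poly P (fps_to_fls (\<gamma> None))) = poly ((pderiv ^^ k) P) (fps_to_fls (\<gamma> None))"
proof -
  have coeffs: "x_deriv \<gamma> (coeff ((pderiv ^^ k) P) i) = 0" for k i
  proof (induction k arbitrary: i)
    case 0
    show ?case using assms(2) by simp
  next
    case (Suc k)
    have "x_deriv \<gamma> (of_nat n) = 0" for n by (simp add: x_deriv_def)
    then show ?case using Suc by (simp add: coeff_pderiv del: of_nat_Suc)
  qed
  show ?thesis
    by (induction k) (simp_all add: x_deriv_poly[where \<gamma> = \<gamma>, OF x] coeffs)
qed

lemma x_deriv_iterated_add: "(x_deriv \<gamma> ^^ k) (g + h) = (x_deriv \<gamma> ^^ k) g + (x_deriv \<gamma> ^^ k) h"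
  by (induction k) simp_all

lemma x_deriv_iterated_const_mult:
  "(x_deriv \<gamma> ^^ k) (fls_const c * h) = fls_const c * (x_deriv \<gamma> ^^ k) h"
  by (induction k) simp_all

lemma x_deriv_iterated_sum: "(x_deriv \<gamma> ^^ k) (\<Sum>i\<in>I. g i) = (\<Sum>i\<in>I. (x_deriv \<gamma> ^^ k) (g i))"
  by (induction k) (simp_all add: x_deriv_sum)

section \<open>From fields with complex coefficients to independent variables\<close>

lemma infinite_range_fls_const: "infinite (range (fls_const :: complex \<Rightarrow> complex fls))"
proof -
  have "inj (fls_const :: complex \<Rightarrow> complex fls)"
    by (rule injI) (metis fls_const_nth)
  then show ?thesis
    using finite_imageD infinite_UNIV_char_0 by blast
qed

text \<open>Differentiation lowers the order of a nonzero series vanishing at 0 by exactly one. So f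
  / f' is a power series without constant term even if f' vanishes at 0.\<close>

lemma fps_deriv_quotient:
  fixes f :: "complex fps"
  assumes "fps_nth f 0 = 0" "fps_deriv f \<noteq> 0"
  obtains q where "f = fps_deriv f * q" "fps_nth q 0 = 0"
proof -
  have f: "f \<noteq> 0" using assms(2) by auto
  with assms(1) have pos: "subdegree f > 0" by (simp add: subdegree_pos_iff)
  then obtain n where n: "subdegree f = Suc n" by (cases "subdegree f") auto
  have sub: "subdegree (fps_deriv f) = n"
  proof (rule subdegreeI)
    have "fps_nth f (Suc n) \<noteq> 0" using f n by (metis nth_subdegree_nonzero)
    then show "fps_nth (fps_deriv f) n \<noteq> 0" by (simp del: of_nat_Suc)
    fix i assume "i < n"
    then have "fps_nth f (Suc i) = 0" using n by (intro nth_less_subdegree_zero) simp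
    then show "fps_nth (fps_deriv f) i = 0" by simp
  qed
  have "fps_deriv f dvd f"
    using assms(2) f by (simp add: fps_dvd_iff sub n)
  then obtain q where q: "f = fps_deriv f * q" by (rule dvdE)
  with f have "q \<noteq> 0" by auto
  with assms(2) have "subdegree (fps_deriv f * q) = subdegree (fps_deriv f) + subdegree q"
    by (rule subdegree_mult)
  then have "subdegree f = subdegree (fps_deriv f) + subdegree q"
    by (simp only: q[symmetric])
  then have "subdegree q > 0" using sub n by simp
  then have "fps_nth q 0 = 0" by (rule nth_less_subdegree_zero)
  with q show ?thesis by (rule that)
qed

lemma formal_jet_identity:
  assumes x: "fps_deriv (\<gamma> None) \<noteq> 0" and x0: "fps_nth (\<gamma> None) 0 = 0"
    and F: "polyfun F"
    and zero: "\<And>u. fps_nth u 0 \<noteq> 0 \<Longrightarrow>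
      F (\<lambda>k. (x_deriv \<gamma> ^^ k) (jet \<gamma> (None, 1) * fps_to_fls u)) = 0"
  shows "F U = 0"
proof -
  define X where "X = fps_to_fls (\<gamma> None)"
  define X' where "X' = jet \<gamma> (None, 1)"
  define D where "D = (\<lambda>k. x_deriv \<gamma> ^^ k)"
  obtain N where N: "\<And>U V. (\<forall>i<N. U i = V i) \<Longrightarrow> F U = F V"
    using polyfun_finitely_many_args[OF F] by blast
  \<comment> \<open>For complex coefficients \<open>a\<close>, \<open>L a\<close> is the sequence of
    D-derivatives of g. For other Laurent series it is merely the linear extension of that formula,
    since D need not kill them.\<close>
  define L where "L = (\<lambda>a k. a 0 * D k X' + (\<Sum>i=1..Suc N. a i * D k (X ^ i)))"
  obtain q where q: "\<gamma> None = fps_deriv (\<gamma> None) * q" "fps_nth q 0 = 0"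
    using fps_deriv_quotient[OF x0 x] by blast
  have zero_L: "F (L a) = 0" for a
  proof (rule polyfun_eq_0[of "\<lambda>a. F (L a)" "\<lambda>i. if i = 0 then range fls_const - {0} else range fls_const"])
    show "polyfun (\<lambda>a. F (L a))"
      unfolding L_def by (intro polyfun_compose[OF F] polyfun.add polyfun.mult polyfun_sum)
        (auto intro: polyfun.intros)
    show "infinite (if i = 0 then range fls_const - {0} else range (fls_const :: complex \<Rightarrow> complex fls))"
      for i :: nat using infinite_range_fls_const by auto
    fix a :: "nat \<Rightarrow> complex fls"
    assume a: "\<And>i. a i \<in> (if i = 0 then range fls_const - {0} else range fls_const)"
    have "\<exists>c. a i = fls_const c" for i using a[of i] by (auto split: if_splits)
    then obtain c where c: "\<And>i. a i = fls_const (c i)" by metis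
    have c0: "c 0 \<noteq> 0" using a[of 0] c[of 0] by auto
    \<comment> \<open>This is g / x'. Its constant coefficient is \<open>c 0\<close> because
      \<open>q\<close> vanishes at 0, which is why 0 is excluded as a value of
      \<open>a 0\<close>.\<close>
    define u where "u = fps_const (c 0) + q * (\<Sum>i=1..Suc N. fps_const (c i) * \<gamma> None ^ (i - 1))"
    have u0: "fps_nth u 0 \<noteq> 0" using c0 q(2) by (simp add: u_def fps_mult_nth_0)
    have "fps_deriv (\<gamma> None) * u = fps_const (c 0) * fps_deriv (\<gamma> None) +
        (\<Sum>i=1..Suc N. fps_const (c i) * (\<gamma> None * \<gamma> None ^ (i - 1)))"
    proof -
      have "fps_deriv (\<gamma> None) * u = fps_const (c 0) * fps_deriv (\<gamma> None) +
        (fps_deriv (\<gamma> None) * q) * (\<Sum>i=1..Suc N. fps_const (c i) * \<gamma> None ^ (i - 1))"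
        by (simp only: u_def distrib_left mult.assoc mult.commute[of "fps_deriv (\<gamma> None)" "fps_const (c 0)"])
      then show ?thesis
        by (simp only: q(1)[symmetric] sum_distrib_left mult.left_commute)
    qed
    also have "(\<Sum>i=1..Suc N. fps_const (c i) * (\<gamma> None * \<gamma> None ^ (i - 1))) =
        (\<Sum>i=1..Suc N. fps_const (c i) * \<gamma> None ^ i)"
      by (intro sum.cong refl arg_cong2[of _ _ _ _ "(*)"]) (auto simp flip: power_Suc)
    finally have "fps_to_fls (fps_deriv (\<gamma> None) * u) = fps_to_fls (fps_const (c 0) * fps_deriv (\<gamma> None) +
        (\<Sum>i=1..Suc N. fps_const (c i) * \<gamma> None ^ i))" by simp
    moreover have "fps_to_fls (\<Sum>i\<in>I. g i) = (\<Sum>i\<in>I. fps_to_fls (g i))" for I and g :: "nat \<Rightarrow> complex fps"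
      by (induction I rule: infinite_finite_induct) auto
    ultimately have g: "X' * fps_to_fls u = fls_const (c 0) * X' + (\<Sum>i=1..Suc N. fls_const (c i) * X ^ i)"
      by (simp add: X'_def X_def jet_def fls_times_fps_to_fls fps_to_fls_power)
    have "L a = (\<lambda>k. D k (X' * fps_to_fls u))"
      unfolding g by (simp add: fun_eq_iff L_def D_def c x_deriv_iterated_add x_deriv_iterated_const_mult
          x_deriv_iterated_sum del: sum.cl_ivl_Suc)
    then show "F (L a) = 0"
      using zero[OF u0] by (simp add: D_def X'_def)
  qed
  \<comment> \<open>The interpolating polynomial has Laurent series as coefficients; this is what
    the extension beyond complex coefficients was for. The x' term is no longer needed and gets the
    coefficient 0.\<close>
  have "\<exists>a. \<forall>k<N. L a k = U k"
  proof -
    have "X \<noteq> 0" using x by (auto simp: X_def)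
    then obtain P where P: "degree P \<le> Suc N" "coeff P 0 = 0"
      "\<And>k. k \<le> N \<Longrightarrow> poly ((pderiv ^^ k) P) X = U k"
      using poly_with_prescribed_derivatives[of X N U] by blast
    have "(\<Sum>i=1..Suc N. smult (coeff P i) (monom 1 i)) = (\<Sum>i\<le>Suc N. monom (coeff P i) i)"
      by (rule sum.mono_neutral_cong_left) (auto simp: smult_monom P(2) not_le)
    also have "\<dots> = P" using P(1) by (rule poly_as_sum_of_monoms')
    finally have sum: "P = (\<Sum>i=1..Suc N. smult (coeff P i) (monom 1 i))" by simp
    have "L ((coeff P)(0 := 0)) k = U k" if "k < N" for k
    proof -
      have D: "D k (X ^ i) = poly ((pderiv ^^ k) (monom 1 i)) X" for i
        using x_deriv_iterated_poly[where \<gamma> = \<gamma> and P = "monom 1 i" and k = k, OF x]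
        by (auto simp: D_def X_def poly_monom)
      have "L ((coeff P)(0 := 0)) k = (\<Sum>i=1..Suc N. coeff P i * D k (X ^ i))"
        by (auto simp: L_def intro!: sum.cong)
      also have "\<dots> = poly ((pderiv ^^ k) (\<Sum>i=1..Suc N. smult (coeff P i) (monom 1 i))) X"
        by (simp add: higher_pderiv_sum higher_pderiv_smult poly_sum D del: sum.cl_ivl_Suc)
      also have "\<dots> = U k" using P(3)[of k] that by (simp only: sum[symmetric])
      finally show ?thesis .
    qed
    then show ?thesis by blast
  qed
  then obtain a where "\<forall>k<N. L a k = U k" by blast
  then have "F (L a) = F U" by (rule N)
  then show ?thesis by (simp add: zero_L)
qed

text \<open>\<open>A\<close> and \<open>B\<close> are numerator and denominator of p along the field
  g D, with g, D g, ... replaced by independent arguments \<open>U\<close>. That \<open>B\<close> is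
  nonzero somewhere makes a later specialization possible; the last two equations are the case g =
  1.\<close>

lemma geometric_invariant_formally:
  fixes \<gamma> :: "'n option \<Rightarrow> complex fps"
  assumes x: "fps_deriv (\<gamma> None) \<noteq> 0" and x0: "fps_nth (\<gamma> None) 0 = 0"
    and derivatives: "in_derivatives p" and defined: "rat_defined (jet \<gamma>) p"
    and inv: "geometric_invariant \<gamma> p"
  shows "\<exists>A B.
    (\<forall>U. mpol_eval fls_const (field_jet \<gamma> U) A = rat_eval (jet \<gamma>) p * mpol_eval fls_const (field_jet \<gamma> U) B) \<and>
    (\<exists>U. mpol_eval fls_const (field_jet \<gamma> U) B \<noteq> 0) \<and>
    mpol_eval fls_const (field_jet \<gamma> (\<lambda>k. if k = 0 then 1 else 0)) A = mpol_eval fls_const (i_kappa \<gamma>) (fst p) \<and>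
    mpol_eval fls_const (field_jet \<gamma> (\<lambda>k. if k = 0 then 1 else 0)) B = mpol_eval fls_const (i_kappa \<gamma>) (snd p)"
proof -
  define field where "field = (\<lambda>g (v, i). ((\<lambda>h. g * x_deriv \<gamma> h) ^^ i) (fps_to_fls (\<gamma> v)))"
  define jets where "jets = (\<lambda>g k. (x_deriv \<gamma> ^^ k) g)"
  have ex: "\<exists>T. \<forall>g. mpol_eval fls_const (field_jet \<gamma> (jets g)) T = field g w" if "snd w \<ge> 1" for w
    unfolding field_def jets_def case_prod_beta
    by (rule ex_universal_jet[where \<gamma> = \<gamma>, OF x that])
  \<comment> \<open>At order 0 the choice is arbitrary; by \<open>in_derivatives\<close> such
    variables do not occur in p.\<close>
  define T where "T = (\<lambda>w. SOME T. \<forall>g. mpol_eval fls_const (field_jet \<gamma> (jets g)) T = field g w)"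
  have T: "mpol_eval fls_const (field_jet \<gamma> (jets g)) (T w) = field g w" if "snd w \<ge> 1" for w g
    using someI_ex[OF ex[OF that]] unfolding T_def by (rule spec)
  have order_ge_1: "snd w \<ge> 1"
    if "P \<in> {fst p, snd p}" "m \<in> Poly_Mapping.keys P" "w \<in> Poly_Mapping.keys m" for P m w
    using that derivatives unfolding in_derivatives_def by (cases w) fastforce
  define star where "star = mpol_eval (Poly_Mapping.single 0) T"
  define E where "E = (\<lambda>P U. mpol_eval fls_const (field_jet \<gamma> U) (star P))"
  have E_jets: "E P (jets g) = mpol_eval fls_const (field g) P" if "P \<in> {fst p, snd p}" for P g
  proof -
    have "E P (jets g) = mpol_eval fls_const (\<lambda>w. mpol_eval fls_const (field_jet \<gamma> (jets g)) (T w)) P"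
      unfolding E_def star_def
      by (rule mpol_const.mpol_eval_hom[where \<sigma> = "mpol_eval fls_const (field_jet \<gamma> (jets g))"])
        (simp_all add: fls_const.coeff_hom_axioms)
    also have "\<dots> = mpol_eval fls_const (field g) P"
    proof (rule mpol_eval_cong)
      fix m w
      assume "m \<in> Poly_Mapping.keys P" "w \<in> Poly_Mapping.keys m"
      then have "snd w \<ge> 1" by (rule order_ge_1[OF that])
      then show "mpol_eval fls_const (field_jet \<gamma> (jets g)) (T w) = field g w" by (rule T)
    qed
    finally show ?thesis .
  qed
  define p0 where "p0 = rat_eval (jet \<gamma>) p"
  define X' where "X' = jet \<gamma> (None, 1)"
  have X': "X' \<noteq> 0" using jet_None_nonzero[where \<gamma> = \<gamma>, OF x] by (simp add: X'_def)
  have field_u: "field (X' * u) (v, i) = ((\<lambda>h. u * fls_deriv h) ^^ i) (fps_to_fls (\<gamma> v))" for u v i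
    using X' by (simp add: field_def x_deriv_def X'_def)
  have "(fls_deriv ^^ i) (fps_to_fls (\<gamma> v)) = jet \<gamma> (v, i)" for v i
    by (induction i) (simp_all add: jet_Suc, simp add: jet_def)
  \<comment> \<open>The case u = 1: the field is d/dt, and its iterates give the jet of
    \<open>\<gamma>\<close> itself.\<close>
  then have field_1: "field X' = jet \<gamma>"
    using field_u[of 1] by auto
  have poly: "polyfun (E P)" for P
    unfolding E_def
  proof (rule fls_const.polyfun_mpol_eval)
    fix w show "polyfun (\<lambda>U. field_jet \<gamma> U w)"
      by (cases w) (auto simp: field_jet_def intro: polyfun.intros)
  qed
  have eq: "E (fst p) U - p0 * E (snd p) U = 0" for U
  proof (rule polyfun_mult_eq_0[of "E (snd p)" "\<lambda>U. E (fst p) U - p0 * E (snd p) U"])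
    show "polyfun (E (snd p))" "polyfun (\<lambda>U. E (fst p) U - p0 * E (snd p) U)"
      by (intro polyfun_diff polyfun.mult poly polyfun.const)+
    show "E (snd p) (jets X') \<noteq> 0"
      using defined E_jets[of "snd p"] by (simp add: field_1 rat_defined_def)
    fix U
    show "E (snd p) U * (E (fst p) U - p0 * E (snd p) U) = 0"
    proof (rule formal_jet_identity[where \<gamma> = \<gamma> and U = U and
          F = "\<lambda>U. E (snd p) U * (E (fst p) U - p0 * E (snd p) U)", OF x x0])
      show "polyfun (\<lambda>U. E (snd p) U * (E (fst p) U - p0 * E (snd p) U))"
        by (intro polyfun_diff polyfun.mult poly polyfun.const)
      fix u :: "complex fps"
      assume "fps_nth u 0 \<noteq> 0"
      then obtain \<phi> where \<phi>: "subdegree \<phi> = 1" "fps_deriv \<phi> = u oo \<phi>"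
        using ex_reparam_flow by blast
      let ?g = "X' * fps_to_fls u"
      have jet: "jet (reparam \<gamma> \<phi>) = (\<lambda>w. fls_compose_fps (field ?g w) \<phi>)"
      proof
        fix w show "jet (reparam \<gamma> \<phi>) w = fls_compose_fps (field ?g w) \<phi>"
          by (cases w) (simp only: field_u jet_reparam_flow[OF \<phi>])
      qed
      have "E (snd p) (jets ?g) * (E (fst p) (jets ?g) - p0 * E (snd p) (jets ?g)) = 0"
      proof (cases "E (snd p) (jets ?g) = 0")
        case False
        have "rat_defined (jet (reparam \<gamma> \<phi>)) p"
          using False subdegree_1D[OF \<phi>(1)]
          by (simp add: rat_defined_def jet E_jets fls_compose_fps_eq_0_iff
              flip: fls_compose_mpol_eval[OF \<phi>(1)])
        then have "fls_compose_fps p0 \<phi> = rat_eval (jet (reparam \<gamma> \<phi>)) p"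
          using inv \<phi>(1) unfolding geometric_invariant_def p0_def by blast
        also have "\<dots> = fls_compose_fps (rat_eval (field ?g) p) \<phi>"
          unfolding jet by (rule fls_compose_rat_eval[OF \<phi>(1), symmetric])
        finally have "fls_compose_fps (p0 - rat_eval (field ?g) p) \<phi> = 0"
          using subdegree_1D[OF \<phi>(1)] by (simp add: fls_compose_fps_diff)
        then have "p0 = rat_eval (field ?g) p"
          using subdegree_1D[OF \<phi>(1)] by (simp add: fls_compose_fps_eq_0_iff)
        then show ?thesis
          using False by (simp add: rat_eval_def E_jets)
      qed simp
      then show "E (snd p) (\<lambda>k. (x_deriv \<gamma> ^^ k) (jet \<gamma> (None, 1) * fps_to_fls u)) *
        (E (fst p) (\<lambda>k. (x_deriv \<gamma> ^^ k) (jet \<gamma> (None, 1) * fps_to_fls u)) -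
         p0 * E (snd p) (\<lambda>k. (x_deriv \<gamma> ^^ k) (jet \<gamma> (None, 1) * fps_to_fls u))) = 0"
        unfolding jets_def X'_def .
    qed
  qed
  have jets_1: "jets 1 = (\<lambda>k. if k = 0 then 1 else 0)"
    by (auto simp: jets_def x_deriv_iterated_1)
  have field_i_kappa: "mpol_eval fls_const (field 1) P = mpol_eval fls_const (i_kappa \<gamma>) P"
    if "P \<in> {fst p, snd p}" for P
  proof (rule mpol_eval_cong)
    fix m w
    assume "m \<in> Poly_Mapping.keys P" "w \<in> Poly_Mapping.keys m"
    then have "snd w \<ge> 1" by (rule order_ge_1[OF that])
    then show "field 1 w = i_kappa \<gamma> w"
      by (cases w) (simp add: field_def i_kappa_eq_iterated_x_deriv[where \<gamma> = \<gamma>, OF x])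
  qed
  show ?thesis
  proof (rule exI[of _ "star (fst p)"], rule exI[of _ "star (snd p)"], intro conjI allI)
    show "mpol_eval fls_const (field_jet \<gamma> U) (star (fst p)) =
        rat_eval (jet \<gamma>) p * mpol_eval fls_const (field_jet \<gamma> U) (star (snd p))" for U
      using eq[of U] by (simp add: E_def p0_def)
    show "\<exists>U. mpol_eval fls_const (field_jet \<gamma> U) (star (snd p)) \<noteq> 0"
      using defined E_jets[of "snd p" X'] by (intro exI[of _ "jets X'"]) (simp add: field_1 rat_defined_def E_def)
    show "mpol_eval fls_const (field_jet \<gamma> (\<lambda>k. if k = 0 then 1 else 0)) (star (fst p)) =
        mpol_eval fls_const (i_kappa \<gamma>) (fst p)"
      using E_jets[of "fst p" 1] by (simp add: field_i_kappa E_def jets_1)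
    show "mpol_eval fls_const (field_jet \<gamma> (\<lambda>k. if k = 0 then 1 else 0)) (star (snd p)) =
        mpol_eval fls_const (i_kappa \<gamma>) (snd p)"
      using E_jets[of "snd p" 1] by (simp add: field_i_kappa E_def jets_1)
  qed
qed

lemma geometric_invariant_imp_curvatures:
  fixes \<gamma> :: "'n option \<Rightarrow> complex fps" and p :: "('n option \<times> nat) ratexp"
  assumes x: "fps_deriv (\<gamma> None) \<noteq> 0" and x0: "fps_nth (\<gamma> None) 0 = 0"
    and derivatives: "in_derivatives p" and defined: "rat_defined (jet \<gamma>) p"
    and inv: "geometric_invariant \<gamma> p"
  shows "\<exists>q. rat_defined (slopes_curvatures \<gamma>) q \<and>
      rat_eval (jet \<gamma>) p = rat_eval (slopes_curvatures \<gamma>) q"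
    and "i_kappa_invariant \<gamma> p"
proof -
  obtain A B where AB:
    "\<And>U. mpol_eval fls_const (field_jet \<gamma> U) A = rat_eval (jet \<gamma>) p * mpol_eval fls_const (field_jet \<gamma> U) B"
    "\<exists>U. mpol_eval fls_const (field_jet \<gamma> U) B \<noteq> 0"
    "mpol_eval fls_const (field_jet \<gamma> (\<lambda>k. if k = 0 then 1 else 0)) A = mpol_eval fls_const (i_kappa \<gamma>) (fst p)"
    "mpol_eval fls_const (field_jet \<gamma> (\<lambda>k. if k = 0 then 1 else 0)) B = mpol_eval fls_const (i_kappa \<gamma>) (snd p)"
    using geometric_invariant_formally[where \<gamma> = \<gamma> and p = p, OF assms]
    by (elim exE conjE) (rule that, auto)
  have "mpol_eval fls_const (jet \<gamma>) (fst p) = rat_eval (jet \<gamma>) p * mpol_eval fls_const (jet \<gamma>) (snd p)"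
    using defined by (simp add: rat_eval_def rat_defined_def)
  \<comment> \<open>The identity at g = 1 expresses \<open>i_kappa\<close> of the numerator as the
    value of p times \<open>i_kappa\<close> of the denominator, without any division; the latter may
    therefore vanish.\<close>
  then show "i_kappa_invariant \<gamma> p"
    unfolding i_kappa_invariant_def by (simp flip: AB(3,4)) (simp add: AB(1))
  \<comment> \<open>To express p in the curvatures the denominator must survive the specialization.
    This can fail for g = 1, so suitable complex values for g, D g, ... are taken; they need not
    come from an actual field.\<close>
  have "\<exists>c. mpol_eval fls_const (field_jet \<gamma> (\<lambda>k. fls_const (c k))) B \<noteq> 0"
  proof (rule ccontr)
    assume contra: "\<not> ?thesis"
    have "mpol_eval fls_const (field_jet \<gamma> U) B = 0" for U
    proof (rule polyfun_eq_0[of "\<lambda>U. mpol_eval fls_const (field_jet \<gamma> U) B" "\<lambda>i. range fls_const"])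
      show "polyfun (\<lambda>U. mpol_eval fls_const (field_jet \<gamma> U) B)"
      proof (rule fls_const.polyfun_mpol_eval)
        fix w show "polyfun (\<lambda>U. field_jet \<gamma> U w)"
          by (cases w) (auto simp: field_jet_def intro: polyfun.intros)
      qed
      show "infinite (range (fls_const :: complex \<Rightarrow> complex fls))"
        by (rule infinite_range_fls_const)
      fix U :: "nat \<Rightarrow> complex fls"
      assume U: "\<And>i. U i \<in> range fls_const"
      have "U = (\<lambda>i. fls_const (fls_nth (U i) 0))"
      proof
        fix i show "U i = fls_const (fls_nth (U i) 0)" using U[of i] by auto
      qed
      moreover have "mpol_eval fls_const (field_jet \<gamma> (\<lambda>i. fls_const (fls_nth (U i) 0))) B = 0"
        using contra[unfolded not_ex not_not] by (rule spec)
      ultimately show "mpol_eval fls_const (field_jet \<gamma> U) B = 0" by simp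
    qed
    with AB(2) show False by blast
  qed
  then obtain c where c: "mpol_eval fls_const (field_jet \<gamma> (\<lambda>k. fls_const (c k))) B \<noteq> 0" by blast
  define \<sigma> where "\<sigma> = mpol_eval (Poly_Mapping.single 0) (case_sum (mvar :: 'n \<times> nat \<Rightarrow> _) (\<lambda>k. Poly_Mapping.single 0 (c k)))"
  have \<sigma>: "mpol_eval fls_const (slopes_curvatures \<gamma>) (\<sigma> P) =
      mpol_eval fls_const (field_jet \<gamma> (\<lambda>k. fls_const (c k))) P" for P
  proof -
    have "mpol_eval fls_const (slopes_curvatures \<gamma>) (\<sigma> P) = mpol_eval fls_const
      (\<lambda>v. mpol_eval fls_const (slopes_curvatures \<gamma>) (case v of Inl w \<Rightarrow> mvar w | Inr k \<Rightarrow> Poly_Mapping.single 0 (c k))) P"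
      unfolding \<sigma>_def
      by (rule mpol_const.mpol_eval_hom[where \<sigma> = "mpol_eval fls_const (slopes_curvatures \<gamma>)"])
        (simp_all add: fls_const.coeff_hom_axioms)
    also have "\<dots> = mpol_eval fls_const (field_jet \<gamma> (\<lambda>k. fls_const (c k))) P"
      by (intro arg_cong[of _ _ "\<lambda>a. mpol_eval fls_const a P"]) (auto simp: field_jet_def split: sum.split)
    finally show ?thesis .
  qed
  have "rat_defined (slopes_curvatures \<gamma>) (\<sigma> A, \<sigma> B) \<and>
      rat_eval (jet \<gamma>) p = rat_eval (slopes_curvatures \<gamma>) (\<sigma> A, \<sigma> B)"
    using c AB(1) by (simp add: rat_defined_def rat_eval_def[of "slopes_curvatures \<gamma>"] \<sigma>)
  then show "\<exists>q. rat_defined (slopes_curvatures \<gamma>) q \<and>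
      rat_eval (jet \<gamma>) p = rat_eval (slopes_curvatures \<gamma>) q" by blast
qed

section \<open>Substitution into power series\<close>

definition mdeg :: "'v::finite monom \<Rightarrow> nat" where
  "mdeg m = (\<Sum>v\<in>UNIV. Poly_Mapping.lookup m v)"

lemma mdeg_add: "mdeg (m + n) = mdeg m + mdeg n"
  by (simp add: mdeg_def lookup_add sum.distrib)

lemma lookup_le_mdeg: "Poly_Mapping.lookup m v \<le> mdeg m"
  unfolding mdeg_def by (rule member_le_sum) auto

lemma finite_mdeg_le: "finite {m :: 'v::finite monom. mdeg m \<le> k}"
proof (rule finite_imageD)
  have "Poly_Mapping.lookup ` {m :: 'v monom. mdeg m \<le> k} \<subseteq> PiE UNIV (\<lambda>_. {..k})"
    using lookup_le_mdeg by (auto intro: order_trans)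
  then show "finite (Poly_Mapping.lookup ` {m :: 'v monom. mdeg m \<le> k})"
    by (rule finite_subset) (intro finite_PiE; simp)
  show "inj_on Poly_Mapping.lookup {m :: 'v monom. mdeg m \<le> k}"
    by (auto intro!: inj_onI poly_mapping_eqI)
qed

lemma monom_eval_UNIV: "monom_eval a m = (\<Prod>v\<in>UNIV. a v ^ Poly_Mapping.lookup m v)"
  for m :: "'v::finite monom"
  by (rule monom_eval_superset) auto

lemma fps_nth_monom_eval_eq_0:
  fixes \<gamma> :: "'v::finite \<Rightarrow> complex fps"
  assumes "\<And>v. fps_nth (\<gamma> v) 0 = 0" "k < mdeg m"
  shows "fps_nth (monom_eval \<gamma> m) k = 0"
proof -
  have "\<gamma> v = fps_X * fps_shift 1 (\<gamma> v)" for v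
    using assms(1)[of v] by (intro fps_ext) auto
  then have "monom_eval \<gamma> m = monom_eval (\<lambda>v. fps_X * fps_shift 1 (\<gamma> v)) m"
    by simp
  also have "\<dots> = fps_X ^ mdeg m * monom_eval (\<lambda>v. fps_shift 1 (\<gamma> v)) m"
    by (simp add: monom_eval_UNIV mdeg_def power_mult_distrib prod.distrib power_sum)
  finally show ?thesis using assms(2) by (simp add: fps_X_power_mult_nth)
qed

text \<open>A single bound \<open>K\<close> for all coefficients up to \<open>K\<close> lets
  products be computed over one finite set of monomials; the additional monomials contribute
  0.\<close>

lemma fps_nth_mps_subst:
  fixes \<gamma> :: "'v::finite \<Rightarrow> complex fps"
  assumes "\<And>v. fps_nth (\<gamma> v) 0 = 0" "k \<le> K"
  shows "fps_nth (mps_subst \<gamma> F) k = (\<Sum>m | mdeg m \<le> K. F m * fps_nth (monom_eval \<gamma> m) k)"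
proof -
  have "fps_nth (mps_subst \<gamma> F) k = (\<Sum>m | mdeg m \<le> k. F m * fps_nth (monom_eval \<gamma> m) k)"
    by (simp add: mps_subst_def mdeg_def monom_eval_UNIV)
  also have "\<dots> = (\<Sum>m | mdeg m \<le> K. F m * fps_nth (monom_eval \<gamma> m) k)"
    using assms by (intro sum.mono_neutral_left)
      (auto simp: finite_mdeg_le not_le fps_nth_monom_eval_eq_0)
  finally show ?thesis .
qed

lemma mps_subst_sum:
  "mps_subst \<gamma> (\<lambda>m. \<Sum>i\<in>I. F i m) = (\<Sum>i\<in>I. mps_subst \<gamma> (F i))"
proof (rule fps_ext)
  fix k
  show "fps_nth (mps_subst \<gamma> (\<lambda>m. \<Sum>i\<in>I. F i m)) k = fps_nth (\<Sum>i\<in>I. mps_subst \<gamma> (F i)) k"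
    by (simp add: mps_subst_def fps_sum_nth sum_distrib_right) (rule sum.swap)
qed

lemma mps_subst_mult:
  fixes \<gamma> :: "'v::finite \<Rightarrow> complex fps"
  assumes \<gamma>: "\<And>v. fps_nth (\<gamma> v) 0 = 0"
  shows "mps_subst \<gamma> (mps_mult F G) = mps_subst \<gamma> F * mps_subst \<gamma> G"
proof (rule fps_ext)
  fix k
  define S where "S = {m :: 'v monom. mdeg m \<le> k}"
  have fin: "finite S" unfolding S_def by (rule finite_mdeg_le)
  let ?t = "\<lambda>(a, b). F a * G b * fps_nth (monom_eval \<gamma> (a + b)) k"
  have pairs: "{(a, b). a + b = m} \<subseteq> S \<times> S" if "m \<in> S" for m
    using that by (auto simp: S_def mdeg_add)
  have "fps_nth (mps_subst \<gamma> F * mps_subst \<gamma> G) k =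
      (\<Sum>i=0..k. (\<Sum>a\<in>S. F a * fps_nth (monom_eval \<gamma> a) i) * (\<Sum>b\<in>S. G b * fps_nth (monom_eval \<gamma> b) (k - i)))"
    unfolding fps_mult_nth S_def
    by (intro sum.cong refl arg_cong2[of _ _ _ _ "(*)"] fps_nth_mps_subst \<gamma>) auto
  also have "\<dots> = (\<Sum>i=0..k. \<Sum>a\<in>S. \<Sum>b\<in>S. F a * G b * (fps_nth (monom_eval \<gamma> a) i * fps_nth (monom_eval \<gamma> b) (k - i)))"
    by (simp add: sum_product mult_ac)
  also have "\<dots> = (\<Sum>a\<in>S. \<Sum>b\<in>S. \<Sum>i=0..k. F a * G b * (fps_nth (monom_eval \<gamma> a) i * fps_nth (monom_eval \<gamma> b) (k - i)))"
    by (subst sum.swap, intro sum.cong refl sum.swap)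
  also have "\<dots> = (\<Sum>a\<in>S. \<Sum>b\<in>S. ?t (a, b))"
    by (simp add: monom_eval_add fps_mult_nth sum_distrib_left)
  also have "\<dots> = (\<Sum>ab\<in>S \<times> S. ?t ab)"
    by (simp add: sum.cartesian_product)
  also have "\<dots> = (\<Sum>ab\<in>{ab \<in> S \<times> S. fst ab + snd ab \<in> S}. ?t ab)"
  proof (rule sum.mono_neutral_right)
    have "fps_nth (monom_eval \<gamma> m) k = 0" if "m \<notin> S" for m
      using that by (intro fps_nth_monom_eval_eq_0 \<gamma>) (simp add: S_def)
    then show "\<forall>ab\<in>S \<times> S - {ab \<in> S \<times> S. fst ab + snd ab \<in> S}. ?t ab = 0"
      by (simp add: case_prod_beta)
  qed (use fin in auto)
  also have "\<dots> = (\<Sum>m\<in>S. \<Sum>ab\<in>{ab \<in> {ab \<in> S \<times> S. fst ab + snd ab \<in> S}. fst ab + snd ab = m}. ?t ab)"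
    using fin by (intro sum.group[symmetric]) auto
  also have "\<dots> = (\<Sum>m\<in>S. \<Sum>ab\<in>{(a, b). a + b = m}. ?t ab)"
  proof (intro sum.cong refl)
    fix m assume "m \<in> S"
    then show "{ab \<in> {ab \<in> S \<times> S. fst ab + snd ab \<in> S}. fst ab + snd ab = m} = {(a, b). a + b = m}"
      using pairs[of m] by fastforce
  qed
  also have "\<dots> = (\<Sum>m\<in>S. mps_mult F G m * fps_nth (monom_eval \<gamma> m) k)"
    unfolding mps_mult_def sum_distrib_right by (intro sum.cong refl) auto
  also have "\<dots> = fps_nth (mps_subst \<gamma> (mps_mult F G)) k"
    unfolding S_def by (rule fps_nth_mps_subst[symmetric]) (simp_all add: \<gamma>)
  finally show "fps_nth (mps_subst \<gamma> (mps_mult F G)) k = fps_nth (mps_subst \<gamma> F * mps_subst \<gamma> G) k"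
    by simp
qed

lemma mps_subst_lookup:
  fixes \<gamma> :: "'v::finite \<Rightarrow> complex fps"
  assumes \<gamma>: "\<And>v. fps_nth (\<gamma> v) 0 = 0"
  shows "mps_subst \<gamma> (Poly_Mapping.lookup P) = mpol_eval fps_const \<gamma> P"
proof (rule fps_ext)
  fix k
  have "fps_nth (mps_subst \<gamma> (Poly_Mapping.lookup P)) k =
      (\<Sum>m | mdeg m \<le> k. Poly_Mapping.lookup P m * fps_nth (monom_eval \<gamma> m) k)"
    by (rule fps_nth_mps_subst) (simp_all add: \<gamma>)
  also have "\<dots> = (\<Sum>m\<in>{m. mdeg m \<le> k} \<union> Poly_Mapping.keys P. Poly_Mapping.lookup P m * fps_nth (monom_eval \<gamma> m) k)"
    by (rule sum.mono_neutral_left) (auto simp: finite_mdeg_le not_le fps_nth_monom_eval_eq_0[OF \<gamma>])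
  also have "\<dots> = fps_nth (mpol_eval fps_const \<gamma> P) k"
    by (subst fps_const.mpol_eval_superset[of "{m. mdeg m \<le> k} \<union> Poly_Mapping.keys P"])
      (auto simp: finite_mdeg_le fps_sum_nth)
  finally show "fps_nth (mps_subst \<gamma> (Poly_Mapping.lookup P)) k = fps_nth (mpol_eval fps_const \<gamma> P) k" .
qed

text \<open>The relation between x and y_j used later has power series in x as coefficients; this
  embeds such coefficients into the ring of series in all variables.\<close>

definition univariate_mps :: "'v \<Rightarrow> complex fps \<Rightarrow> 'v mps" where
  "univariate_mps v a = (\<lambda>m. if Poly_Mapping.keys m \<subseteq> {v} then fps_nth a (Poly_Mapping.lookup m v) else 0)"

lemma mdeg_single [simp]: "mdeg (Poly_Mapping.single v k) = k"
proof -
  have "mdeg (Poly_Mapping.single v k) = (\<Sum>w\<in>UNIV. if w = v then k else 0)"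
    unfolding mdeg_def by (intro sum.cong) (auto simp: lookup_single when_def)
  then show ?thesis by simp
qed

lemma mps_subst_univariate:
  fixes \<gamma> :: "'v::finite \<Rightarrow> complex fps"
  assumes \<gamma>: "\<And>v. fps_nth (\<gamma> v) 0 = 0"
  shows "mps_subst \<gamma> (univariate_mps v a) = a oo \<gamma> v"
proof (rule fps_ext)
  fix k
  have "fps_nth (mps_subst \<gamma> (univariate_mps v a)) k =
      (\<Sum>m | mdeg m \<le> k. univariate_mps v a m * fps_nth (monom_eval \<gamma> m) k)"
    by (rule fps_nth_mps_subst) (simp_all add: \<gamma>)
  also have "\<dots> = (\<Sum>m\<in>Poly_Mapping.single v ` {0..k}. univariate_mps v a m * fps_nth (monom_eval \<gamma> m) k)"
  proof (rule sum.mono_neutral_right)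
    show "\<forall>m\<in>{m. mdeg m \<le> k} - Poly_Mapping.single v ` {0..k}.
        univariate_mps v a m * fps_nth (monom_eval \<gamma> m) k = 0"
    proof
      fix m assume m: "m \<in> {m. mdeg m \<le> k} - Poly_Mapping.single v ` {0..k}"
      have "\<not> Poly_Mapping.keys m \<subseteq> {v}"
      proof
        assume "Poly_Mapping.keys m \<subseteq> {v}"
        then have "m = Poly_Mapping.single v (Poly_Mapping.lookup m v)"
          by (intro poly_mapping_eqI) (auto simp: lookup_single when_def in_keys_iff)
        moreover have "Poly_Mapping.lookup m v \<le> k"
          using m lookup_le_mdeg[of m v] by auto
        ultimately show False using m by (metis DiffD2 atLeastAtMost_iff image_eqI zero_le)
      qed
      then show "univariate_mps v a m * fps_nth (monom_eval \<gamma> m) k = 0"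
        by (simp add: univariate_mps_def)
    qed
  qed (auto simp: finite_mdeg_le)
  also have "\<dots> = (\<Sum>i=0..k. univariate_mps v a (Poly_Mapping.single v i) * fps_nth (monom_eval \<gamma> (Poly_Mapping.single v i)) k)"
    by (subst sum.reindex) (auto simp: inj_on_def dest: injD[OF inj_single] arg_cong[of _ _ mdeg])
  also have "\<dots> = fps_nth (a oo \<gamma> v) k"
    by (auto simp: univariate_mps_def fps_compose_nth intro!: sum.cong)
  finally show "fps_nth (mps_subst \<gamma> (univariate_mps v a)) k = fps_nth (a oo \<gamma> v) k" .
qed

section \<open>Algebraic dependence over a subring of power series\<close>

text \<open>The order of \<open>f ^ n\<close> grows without bound, so a series divisible by all of
  these powers cannot have finite order.\<close>

lemma fps_eq_0_if_divisible:
  fixes f h :: "complex fps"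
  assumes "f \<noteq> 0" "fps_nth f 0 = 0" "\<And>n. f ^ n dvd h"
  shows "h = 0"
proof (rule ccontr)
  assume "h \<noteq> 0"
  then have "subdegree (f ^ Suc (subdegree h)) \<le> subdegree h"
    using assms(1) assms(3)[of "Suc (subdegree h)"] by (simp add: fps_dvd_iff del: power_Suc)
  then have le: "Suc (subdegree h) * subdegree f \<le> subdegree h"
    by (simp only: subdegree_power)
  have "1 \<le> subdegree f" using assms by (simp add: subdegree_pos_iff Suc_le_eq)
  then have "Suc (subdegree h) * 1 \<le> Suc (subdegree h) * subdegree f" by (rule mult_le_mono2)
  from order_trans[OF this le] show False by simp
qed

text \<open>
  If \<open>f\<close> has order \<open>e\<close>, division with remainder by \<open>f\<close> shows that \<open>1, t, \<dots>, t\<^sup>e\<^sup>-\<^sup>1\<close> generate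
  all power series over the subring of power series in \<open>f\<close>.
\<close>

lemma fps_expansion_in_powers:
  fixes f h :: "complex fps"
  assumes f: "f \<noteq> 0" "fps_nth f 0 = 0"
  shows "\<exists>a. h = (\<Sum>k<subdegree f. (a k oo f) * fps_X ^ k)"
proof -
  define e where "e = subdegree f"
  define v where "v = fps_shift e f"
  have fv: "f = v * fps_X ^ e" unfolding v_def e_def by (rule subdegree_decompose)
  have v0: "fps_nth v 0 \<noteq> 0" using f(1) by (simp add: v_def e_def)
  \<comment> \<open>Division with remainder: h is its part of degree below \<open>e\<close> plus f
    times \<open>Q h\<close>. Iterating this, the k-th coefficients of the successive remainders
    become the coefficients of the series \<open>a h k\<close>.\<close>
  define Q where "Q = (\<lambda>h. fps_shift e h * inverse v)"
  define a where "a = (\<lambda>h k. Abs_fps (\<lambda>n. fps_nth ((Q ^^ n) h) k))"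
  define R where "R = (\<lambda>h. h - (\<Sum>k<e. (a h k oo f) * fps_X ^ k))"
  have step: "R h = f * R (Q h)" for h
  proof -
    have "a h k = fps_const (fps_nth h k) + fps_X * a (Q h) k" for k
    proof (rule fps_ext)
      fix n show "fps_nth (a h k) n = fps_nth (fps_const (fps_nth h k) + fps_X * a (Q h) k) n"
        by (cases n) (simp_all add: a_def funpow_swap1)
    qed
    then have "a h k oo f = fps_const (fps_nth h k) + f * (a (Q h) k oo f)" for k
      using f(2) by (simp add: fps_compose_add_distrib fps_compose_mult_distrib)
    then have "(\<Sum>k<e. (a h k oo f) * fps_X ^ k) =
        (\<Sum>k<e. fps_const (fps_nth h k) * fps_X ^ k) + f * (\<Sum>k<e. (a (Q h) k oo f) * fps_X ^ k)"
      by (simp add: algebra_simps sum.distrib sum_distrib_left)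
    moreover have "h = (\<Sum>k<e. fps_const (fps_nth h k) * fps_X ^ k) + f * Q h"
    proof -
      have "f * Q h = fps_X ^ e * fps_shift e h * (inverse v * v)"
        by (simp add: fv Q_def mult_ac)
      also have "inverse v * v = 1" using v0 by (rule inverse_mult_eq_1)
      finally have "f * Q h = fps_X ^ e * fps_shift e h" by simp
      moreover have "h = (\<Sum>k<e. fps_const (fps_nth h k) * fps_X ^ k) + fps_X ^ e * fps_shift e h"
      proof (rule fps_ext)
        fix n
        have "(\<Sum>k<e. fps_nth h k * fps_nth (fps_X ^ k) n) = (\<Sum>k<e. if k = n then fps_nth h k else 0)"
          by (intro sum.cong) auto
        then show "fps_nth h n = fps_nth ((\<Sum>k<e. fps_const (fps_nth h k) * fps_X ^ k) + fps_X ^ e * fps_shift e h) n"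
          by (auto simp: fps_sum_nth fps_X_power_mult_nth)
      qed
      ultimately show ?thesis by simp
    qed
    ultimately show ?thesis unfolding R_def by (simp add: algebra_simps)
  qed
  \<comment> \<open>Convergence of the expansion is replaced by divisibility of the error
    \<open>R h\<close> by all powers of f.\<close>
  have "R h = f ^ n * R ((Q ^^ n) h)" for n
  proof (induction n)
    case (Suc n)
    then show ?case using step[of "(Q ^^ n) h"] by (simp add: mult_ac)
  qed simp
  then have "f ^ n dvd R h" for n by (metis dvdI)
  then have "R h = 0" by (rule fps_eq_0_if_divisible[OF f])
  then show ?thesis by (intro exI[of _ "a h"]) (simp add: R_def e_def)
qed

lemma poly_altdef_le:
  fixes P :: "'a::comm_semiring_1 poly"
  assumes "degree P \<le> n"
  shows "poly P x = (\<Sum>i\<le>n. coeff P i * x ^ i)"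
  unfolding poly_altdef using assms
  by (intro sum.mono_neutral_left) (auto simp: coeff_eq_0)

lemma fls_common_denominator:
  assumes "finite I"
  shows "\<exists>n b. \<forall>i\<in>I. fls_X ^ n * u i = fps_to_fls (b i :: complex fps)"
proof -
  have "\<exists>f n. u i = fps_to_fls f / fls_X ^ n" for i by (metis fls_as_quotient)
  then obtain f n where fn: "\<And>i. u i = fps_to_fls (f i) / fls_X ^ (n i)" by metis
  have "fls_X ^ (\<Sum>i\<in>I. n i) * u i = fps_to_fls (fps_X ^ ((\<Sum>i\<in>I. n i) - n i) * f i)" if "i \<in> I" for i
  proof -
    have "n i \<le> (\<Sum>i\<in>I. n i)" using assms that by (intro member_le_sum) auto
    then have "fls_X ^ (\<Sum>i\<in>I. n i) = fls_X ^ ((\<Sum>i\<in>I. n i) - n i) * (fls_X ^ n i :: complex fls)"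
      by (simp flip: power_add)
    then show ?thesis by (simp add: fn[of i] fls_times_fps_to_fls fps_to_fls_power del: fls_divide_X_power)
  qed
  then show ?thesis
    by (intro exI[of _ "\<Sum>i\<in>I. n i"] exI[of _ "\<lambda>i. fps_X ^ ((\<Sum>i\<in>I. n i) - n i) * f i"]) blast
qed

lemma fps_to_fls_sum: "fps_to_fls (\<Sum>i\<in>I. g i) = (\<Sum>i\<in>I. fps_to_fls (g i))"
  by (induction I rule: infinite_finite_induct) auto

text \<open>Laurent series form a vector space over themselves with scalars acting through
  composition with f, and all power series lie in the span of e elements, e being the order of f.
  Hence the e + 1 powers 1, y, ..., y^e satisfy a linear relation.\<close>

lemma fps_algebraic_dependence:
  fixes f y :: "complex fps"
  assumes f: "f \<noteq> 0" "fps_nth f 0 = 0"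
  shows "\<exists>P. P \<noteq> 0 \<and> poly (map_poly (\<lambda>a. a oo f) P) y = 0"
proof -
  define e where "e = subdegree f"
  interpret vs: vector_space "\<lambda>c v. fls_compose_fps c f * (v :: complex fls)"
    by unfold_locales (simp_all add: algebra_simps fls_compose_fps_add fls_compose_fps_mult f)
  define T where "T = (\<lambda>k. fls_X ^ k :: complex fls) ` {..<e}"
  have "fps_to_fls h \<in> vs.span T" for h
  proof -
    obtain a where a: "h = (\<Sum>k<e. (a k oo f) * fps_X ^ k)"
      using fps_expansion_in_powers[OF f, of h] unfolding e_def by blast
    have "fps_to_fls h = (\<Sum>k<e. fls_compose_fps (fps_to_fls (a k)) f * fls_X ^ k)"
      by (subst a) (simp add: fps_to_fls_sum fls_times_fps_to_fls fps_to_fls_power f)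
    also have "\<dots> \<in> vs.span T"
      by (intro vs.span_sum vs.span_scale vs.span_base) (auto simp: T_def)
    finally show ?thesis .
  qed
  then have span: "(\<lambda>i. fps_to_fls y ^ i) ` {..e} \<subseteq> vs.span T"
    by (auto simp flip: fps_to_fls_power)
  have "\<exists>u. (\<Sum>i\<le>e. fls_compose_fps (u i) f * fps_to_fls y ^ i) = 0 \<and> (\<exists>i\<le>e. u i \<noteq> 0)"
  \<comment> \<open>\<open>vs.dependent\<close> speaks of sets, so the case of two coinciding
    powers, which is a relation by itself, is treated apart.\<close>
  proof (cases "inj_on (\<lambda>i. fps_to_fls y ^ i) {..e}")
    case True
    have "card T \<le> e" unfolding T_def using card_image_le[of "{..<e}"] by simp
    moreover have "card ((\<lambda>i. fps_to_fls y ^ i) ` {..e}) = Suc e" using True by (simp add: card_image)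
    ultimately have "vs.dependent ((\<lambda>i. fps_to_fls y ^ i) ` {..e})"
      using vs.independent_span_bound[OF _ _ span] by (fastforce simp: T_def)
    then obtain u v where "v \<in> (\<lambda>i. fps_to_fls y ^ i) ` {..e}" "u v \<noteq> 0"
      "(\<Sum>v\<in>(\<lambda>i. fps_to_fls y ^ i) ` {..e}. fls_compose_fps (u v) f * v) = 0"
      by (subst (asm) vs.dependent_finite) auto
    then show ?thesis
      using True by (intro exI[of _ "\<lambda>i. u (fps_to_fls y ^ i)"]) (auto simp: sum.reindex)
  next
    case False
    then obtain i j where ij: "i \<le> e" "j \<le> e" "i \<noteq> j" "fps_to_fls y ^ i = fps_to_fls y ^ j"
      by (auto simp: inj_on_def)
    let ?u = "\<lambda>k. if k = i then 1 else if k = j then -1 else 0 :: complex fls"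
    have "(\<Sum>k\<le>e. fls_compose_fps (?u k) f * fps_to_fls y ^ k) =
        (\<Sum>k\<in>{i, j}. fls_compose_fps (?u k) f * fps_to_fls y ^ k)"
      using ij by (intro sum.mono_neutral_right) auto
    also have "\<dots> = 0" using ij by simp
    finally show ?thesis using ij(1) by (intro exI[of _ ?u]) auto
  qed
  then obtain u i0 where u: "(\<Sum>i\<le>e. fls_compose_fps (u i) f * fps_to_fls y ^ i) = 0" "i0 \<le> e" "u i0 \<noteq> 0"
    by blast
  obtain n b where b: "\<And>i. i \<in> {..e} \<Longrightarrow> fls_X ^ n * u i = fps_to_fls (b i)"
    using fls_common_denominator[of "{..e}" u] by blast
  define P where "P = (\<Sum>i\<le>e. monom (b i) i)"
  have coeff: "coeff P i = (if i \<le> e then b i else 0)" for i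
    by (simp add: P_def coeff_sum)
  have "fps_to_fls (b i0) \<noteq> 0" using b[of i0] u(2,3) by (simp flip: b)
  then have "P \<noteq> 0" using coeff[of i0] u(2) by auto
  moreover have "poly (map_poly (\<lambda>a. a oo f) P) y = 0"
  proof -
    have deg: "degree (map_poly (\<lambda>a. a oo f) P) \<le> e"
      by (rule degree_le) (simp add: coeff_map_poly coeff)
    have "fps_to_fls (poly (map_poly (\<lambda>a. a oo f) P) y) =
        (\<Sum>i\<le>e. fls_compose_fps (fps_to_fls (b i)) f * fps_to_fls y ^ i)"
      by (subst poly_altdef_le[OF deg])
        (simp add: fps_to_fls_sum fls_times_fps_to_fls fps_to_fls_power f coeff_map_poly coeff)
    also have "\<dots> = (\<Sum>i\<le>e. fls_compose_fps (fls_X ^ n) f * (fls_compose_fps (u i) f * fps_to_fls y ^ i))"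
    proof (intro sum.cong refl)
      fix i assume "i \<in> {..e}"
      from b[OF this, symmetric]
      show "fls_compose_fps (fps_to_fls (b i)) f * fps_to_fls y ^ i =
          fls_compose_fps (fls_X ^ n) f * (fls_compose_fps (u i) f * fps_to_fls y ^ i)"
        by (simp only: fls_compose_fps_mult[OF f] mult.assoc)
    qed
    also have "\<dots> = 0" by (simp only: sum_distrib_left[symmetric] u(1) mult_zero_right)
    finally show ?thesis by simp
  qed
  ultimately show ?thesis by blast
qed

lemma pderiv_map_poly_compose:
  fixes f :: "complex fps"
  assumes "fps_nth f 0 = 0"
  shows "pderiv (map_poly (\<lambda>a. a oo f) P) = map_poly (\<lambda>a. a oo f) (pderiv P)"
proof (rule poly_eqI)
  fix n
  show "coeff (pderiv (map_poly (\<lambda>a. a oo f) P)) n = coeff (map_poly (\<lambda>a. a oo f) (pderiv P)) n"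
    using fps_compose_mult_distrib[OF assms, of "of_nat (Suc n)" "coeff P (Suc n)"]
    by (simp add: coeff_pderiv coeff_map_poly del: of_nat_Suc)
qed

text \<open>A relation of least degree is separable in characteristic 0: its derivative is nonzero
  of smaller degree and cannot vanish at y. Degree 0 is ruled out because composition with f is
  injective.\<close>

lemma fps_separable_dependence:
  fixes f y :: "complex fps"
  assumes f: "f \<noteq> 0" "fps_nth f 0 = 0"
  shows "\<exists>P. poly (map_poly (\<lambda>a. a oo f) P) y = 0 \<and> poly (pderiv (map_poly (\<lambda>a. a oo f) P)) y \<noteq> 0"
proof -
  define ev where "ev = (\<lambda>P. poly (map_poly (\<lambda>a. a oo f) P) y)"
  have "\<exists>P. P \<noteq> 0 \<and> ev P = 0" unfolding ev_def by (rule fps_algebraic_dependence[OF f])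
  then obtain P where P: "P \<noteq> 0" "ev P = 0" and min: "\<And>Q. Q \<noteq> 0 \<and> ev Q = 0 \<Longrightarrow> degree P \<le> degree Q"
    using ex_has_least_nat[of "\<lambda>P. P \<noteq> 0 \<and> ev P = 0" _ degree] by blast
  have "degree P \<noteq> 0"
  proof
    assume "degree P = 0"
    then obtain c where c: "P = [:c:]" by (metis degree_eq_zeroE)
    then have "c oo f = 0" using P(2) by (simp add: ev_def map_poly_pCons)
    then show False using P(1) c f by (simp add: fps_compose_eq_0_iff)
  qed
  then have "pderiv P \<noteq> 0" "degree (pderiv P) < degree P"
    by (simp_all add: pderiv_eq_0_iff degree_pderiv)
  then have "ev (pderiv P) \<noteq> 0" using min[of "pderiv P"] by auto
  then show ?thesis 
    using P(2) by (intro exI[of _ P]) (simp add: ev_def pderiv_map_poly_compose[OF f(2)])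
qed

lemma poly_taylor_mod_square:
  fixes p :: "'a::{comm_ring_1,semiring_no_zero_divisors} poly"
  shows "\<exists>R. poly p (y + h) = poly p y + h * poly (pderiv p) y + h ^ 2 * R"
proof (induction p)
  case 0
  show ?case by (intro exI[of _ 0]) simp
next
  case (pCons a p)
  then obtain R where "poly p (y + h) = poly p y + h * poly (pderiv p) y + h ^ 2 * R" by blast
  then show ?case
    by (intro exI[of _ "poly (pderiv p) y + (y + h) * R"])
      (simp add: pderiv_pCons algebra_simps power2_eq_square)
qed

section \<open>The curve equations determine the slopes\<close>

text \<open>The equation lies in the extended ideal, with cofactor 1 at \<open>k\<close> and 0
  elsewhere, so it has the same image as the zero series.\<close>

lemma equation_vanishes_on_parametrization:
  fixes \<gamma> :: "'v::finite \<Rightarrow> complex fps"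
  assumes par: "parametrization r f \<gamma>" and k: "k \<in> {1..r}"
  shows "mpol_eval fps_const \<gamma> (f k) = 0"
proof -
  have \<gamma>0: "\<And>v. fps_nth (\<gamma> v) 0 = 0"
    and ker: "\<And>F G. mps_subst \<gamma> F = mps_subst \<gamma> G \<longleftrightarrow> (\<lambda>m. F m - G m) \<in> mps_ideal_gen r f"
    using par by (auto simp: parametrization_def)
  have "(\<lambda>m. \<Sum>i=1..r. mps_mult (Poly_Mapping.lookup (if i = k then 1 else 0)) (Poly_Mapping.lookup (f i)) m)
      \<in> mps_ideal_gen r f"
    unfolding mps_ideal_gen_def
    by (intro CollectI exI[of _ "\<lambda>i. Poly_Mapping.lookup (if i = k then 1 else 0)"]) simp
  then have "mps_subst \<gamma> (\<lambda>m. \<Sum>i=1..r. mps_mult (Poly_Mapping.lookup (if i = k then 1 else 0)) (Poly_Mapping.lookup (f i)) m) =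
      mps_subst \<gamma> (\<lambda>_. 0)"
    by (subst ker) simp
  also have "\<dots> = 0" by (simp add: mps_subst_def fps_zero_def)
  also have "mps_subst \<gamma> (\<lambda>m. \<Sum>i=1..r. mps_mult (Poly_Mapping.lookup (if i = k then 1 else 0)) (Poly_Mapping.lookup (f i)) m) =
      (\<Sum>i=1..r. mpol_eval fps_const \<gamma> (if i = k then 1 else 0) * mpol_eval fps_const \<gamma> (f i))"
    by (simp only: mps_subst_sum mps_subst_mult[OF \<gamma>0] mps_subst_lookup[OF \<gamma>0])
  also have "\<dots> = (\<Sum>i=1..r. if i = k then mpol_eval fps_const \<gamma> (f i) else 0)"
    by (intro sum.cong) auto
  also have "\<dots> = mpol_eval fps_const \<gamma> (f k)" using k by simp
  finally show ?thesis .
qed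

text \<open>
  The Jacobian of the equations has full rank in the \<open>y\<close>-directions along the curve. Suppose that \<open>w\<close>
  is a tangent vector without \<open>x\<close>-component. Moving \<open>\<gamma>\<close> by \<open>t\<^sup>M w\<close> changes the elements of the ideal
  only modulo \<open>t\<^sup>2\<^sup>M\<close>. Among these is a relation between \<open>x\<close> and \<open>y\<^sub>j\<close>, which is separable in
  \<open>y\<^sub>j\<close>, and letting \<open>M\<close> grow gives \<open>w\<^sub>j = 0\<close>.
\<close>

lemma vertical_tangent_vector_eq_0:
  fixes \<gamma> :: "'n::finite option \<Rightarrow> complex fps"
  assumes par: "parametrization r f \<gamma>" and x: "fps_deriv (\<gamma> None) \<noteq> 0"
    and w: "\<And>k. k \<in> {1..r} \<Longrightarrow> (\<Sum>j\<in>UNIV. mpol_eval fps_const \<gamma> (mpol_deriv (Some j) (f k)) * w j) = 0"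
  shows "w j = 0"
proof -
  have \<gamma>0: "\<And>v. fps_nth (\<gamma> v) 0 = 0"
    and ker: "\<And>F G. mps_subst \<gamma> F = mps_subst \<gamma> G \<longleftrightarrow> (\<lambda>m. F m - G m) \<in> mps_ideal_gen r f"
    using par by (auto simp: parametrization_def)
  have x0: "\<gamma> None \<noteq> 0" using x by auto
  obtain P where P: "poly (map_poly (\<lambda>a. a oo \<gamma> None) P) (\<gamma> (Some j)) = 0"
    "poly (pderiv (map_poly (\<lambda>a. a oo \<gamma> None) P)) (\<gamma> (Some j)) \<noteq> 0"
    using fps_separable_dependence[OF x0 \<gamma>0] by blast
  define p where "p = map_poly (\<lambda>a. a oo \<gamma> None) P"
  \<comment> \<open>The separable relation as a series in all variables, so that it can also be
    evaluated at displaced tuples. These must keep the x-component, since the coefficients of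
    \<open>p\<close> are already composed with it.\<close>
  define G where "G = (\<lambda>m. \<Sum>i\<le>degree P. mps_mult (univariate_mps None (coeff P i)) (univariate_mps (Some j) (fps_X ^ i)) m)"
  have subst_G: "mps_subst \<delta> G = poly p (\<delta> (Some j))"
    if \<delta>: "\<And>v. fps_nth (\<delta> v) 0 = 0" "\<delta> None = \<gamma> None" for \<delta>
  proof -
    have deg: "degree p \<le> degree P"
      unfolding p_def by (rule degree_le) (simp add: coeff_map_poly coeff_eq_0)
    have "mps_subst \<delta> G = (\<Sum>i\<le>degree P. (coeff P i oo \<gamma> None) * \<delta> (Some j) ^ i)"
      unfolding G_def using \<delta>(1)[of "Some j"]
      by (simp add: mps_subst_sum mps_subst_mult[OF \<delta>(1)] mps_subst_univariate[OF \<delta>(1)] \<delta>(2)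
          flip: fps_compose_power)
    also have "\<dots> = poly p (\<delta> (Some j))"
      by (subst poly_altdef_le[OF deg]) (simp add: p_def coeff_map_poly)
    finally show ?thesis .
  qed
  \<comment> \<open>Injectivity of the parametrization enters here: a series vanishing on
    \<open>\<gamma>\<close> is a combination of the equations.\<close>
  have "mps_subst \<gamma> G = mps_subst \<gamma> (\<lambda>_. 0)"
    using subst_G[of \<gamma>, OF \<gamma>0] P(1) by (simp add: p_def mps_subst_def fps_zero_def)
  then have "G \<in> mps_ideal_gen r f" using ker[of G "\<lambda>_. 0"] by simp
  then obtain H where H: "G = (\<lambda>m. \<Sum>k=1..r. mps_mult (H k) (Poly_Mapping.lookup (f k)) m)"
    unfolding mps_ideal_gen_def by blast
  note f0 = equation_vanishes_on_parametrization[OF par]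
  \<comment> \<open>The displaced value of \<open>G\<close> is t^M w_j p'(y_j) up to a multiple of
    t^(2M), and by membership in the ideal it is itself such a multiple; cancelling t^M leaves the
    claim. \<open>M \<ge> 1\<close> keeps the displaced tuple zero at t = 0.\<close>
  have dvd: "fps_X ^ M dvd w j * poly (pderiv p) (\<gamma> (Some j))" if "M \<ge> 1" for M
  proof -
    let ?b = "\<lambda>v. case v of None \<Rightarrow> 0 | Some j \<Rightarrow> w j"
    define \<delta> where "\<delta> = (\<lambda>v. \<gamma> v + fps_X ^ M * ?b v)"
    have \<delta>0: "fps_nth (\<delta> v) 0 = 0" for v
      using that \<gamma>0 by (simp add: \<delta>_def fps_X_power_mult_nth)
    have "\<exists>R. mpol_eval fps_const \<delta> (f k) = (fps_X ^ M) ^ 2 * R" if k: "k \<in> {1..r}" for k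
    proof -
      have "(\<Sum>v\<in>UNIV. mpol_eval fps_const \<gamma> (mpol_deriv v (f k)) * ?b v) = 0"
        using w[OF k] by (simp add: UNIV_option_conv sum.reindex)
      then show ?thesis
        using fps_const.mpol_eval_taylor[of \<gamma> "fps_X ^ M" ?b "f k"] f0[OF k] by (simp add: \<delta>_def)
    qed
    then obtain R where R: "\<And>k. k \<in> {1..r} \<Longrightarrow> mpol_eval fps_const \<delta> (f k) = (fps_X ^ M) ^ 2 * R k"
      by metis
    have "poly p (\<delta> (Some j)) = mps_subst \<delta> G"
      using subst_G[of \<delta>, OF \<delta>0] by (simp add: \<delta>_def)
    also have "\<dots> = (\<Sum>k=1..r. mps_subst \<delta> (H k) * mpol_eval fps_const \<delta> (f k))"
      by (simp only: H mps_subst_sum mps_subst_mult[OF \<delta>0] mps_subst_lookup[OF \<delta>0])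
    also have "\<dots> = (fps_X ^ M) ^ 2 * (\<Sum>k=1..r. mps_subst \<delta> (H k) * R k)"
      by (simp add: R sum_distrib_left mult_ac)
    finally have 1: "poly p (\<delta> (Some j)) = (fps_X ^ M) ^ 2 * (\<Sum>k=1..r. mps_subst \<delta> (H k) * R k)" .
    obtain S where "poly p (\<delta> (Some j)) = fps_X ^ M * w j * poly (pderiv p) (\<gamma> (Some j)) + (fps_X ^ M * w j) ^ 2 * S"
      using poly_taylor_mod_square[of p "\<gamma> (Some j)" "fps_X ^ M * w j"] P(1) by (auto simp: \<delta>_def p_def)
    with 1 have "fps_X ^ M * (w j * poly (pderiv p) (\<gamma> (Some j))) =
        fps_X ^ M * (fps_X ^ M * ((\<Sum>k=1..r. mps_subst \<delta> (H k) * R k) - w j ^ 2 * S))"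
      by (simp add: algebra_simps power2_eq_square)
    then have "w j * poly (pderiv p) (\<gamma> (Some j)) = fps_X ^ M * ((\<Sum>k=1..r. mps_subst \<delta> (H k) * R k) - w j ^ 2 * S)"
      by (subst (asm) mult_left_cancel) auto
    then show ?thesis by (metis dvdI)
  qed
  have "w j * poly (pderiv p) (\<gamma> (Some j)) = 0"
  proof (rule fps_eq_0_if_divisible[of fps_X])
    fix M
    show "fps_X ^ M dvd w j * poly (pderiv p) (\<gamma> (Some j))"
      using dvd[of M] by (cases "M = 0") auto
  qed simp_all
  then show ?thesis using P(2) by (simp add: p_def)
qed

text \<open>Gaussian elimination, one column at a time. Uniqueness over the whole field supplies the
  pivots, and only operations under which \<open>K\<close> is closed are performed.\<close>

lemma linear_system_solution_in_subfield:
  fixes K :: "'a::field set" and c :: "'i \<Rightarrow> 'j \<Rightarrow> 'a"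
  assumes K: "\<And>a b. a \<in> K \<Longrightarrow> b \<in> K \<Longrightarrow> a - b \<in> K" "\<And>a b. a \<in> K \<Longrightarrow> b \<in> K \<Longrightarrow> a * b \<in> K"
    "\<And>a b. a \<in> K \<Longrightarrow> b \<in> K \<Longrightarrow> a / b \<in> K"
    and "finite J"
    and "\<And>i j. i \<in> I \<Longrightarrow> j \<in> J \<Longrightarrow> c i j \<in> K" "\<And>i. i \<in> I \<Longrightarrow> b i \<in> K"
    and "\<And>i. i \<in> I \<Longrightarrow> (\<Sum>j\<in>J. c i j * s j) = b i"
    and "\<And>w j. (\<And>i. i \<in> I \<Longrightarrow> (\<Sum>j\<in>J. c i j * w j) = 0) \<Longrightarrow> j \<in> J \<Longrightarrow> w j = 0"
  shows "j \<in> J \<Longrightarrow> s j \<in> K"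
  using assms(4-)
proof (induction J arbitrary: c b j rule: finite_induct)
  case (insert l J)
  note fin = insert.hyps and coeffs = insert.prems(2,3) and sol = insert.prems(4) and uniq = insert.prems(5)
  \<comment> \<open>Without a pivot in column \<open>l\<close> the unit vector at \<open>l\<close>
    would solve the homogeneous system.\<close>
  have "\<exists>i\<in>I. c i l \<noteq> 0"
  proof (rule ccontr)
    assume contra: "\<not> ?thesis"
    have "(\<Sum>j\<in>insert l J. c i j * (if j = l then 1 else 0)) = 0" if "i \<in> I" for i
      using fin contra that by (auto intro!: sum.neutral)
    from uniq[OF this, where j = l] show False by simp
  qed
  then obtain i0 where i0: "i0 \<in> I" "c i0 l \<noteq> 0" by blast
  define q where "q = (\<lambda>i. c i l / c i0 l)"
  define c' where "c' = (\<lambda>i j. c i j - q i * c i0 j)"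
  define b' where "b' = (\<lambda>i. b i - q i * b i0)"
  have c'_sum: "(\<Sum>j\<in>J. c' i j * w j) = (\<Sum>j\<in>J. c i j * w j) - q i * (\<Sum>j\<in>J. c i0 j * w j)" for i w
    by (simp add: c'_def left_diff_distrib sum_subtractf sum_distrib_left mult.assoc)
  have sol_l: "(\<Sum>j\<in>J. c i j * s j) = b i - c i l * s l" if "i \<in> I" for i
    using sol[OF that] fin by (simp add: algebra_simps)
  have J: "s j \<in> K" if "j \<in> J" for j
  proof (rule insert.IH[of j c' b'])
    show "j \<in> J" by fact
    have q: "q i \<in> K" if "i \<in> I" for i
      unfolding q_def using coeffs(1) i0(1) that by (intro K(3)) auto
    show "c' i j \<in> K" if "i \<in> I" "j \<in> J" for i j
      unfolding c'_def using coeffs(1) i0(1) that q by (intro K(1,2)) auto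
    show "b' i \<in> K" if "i \<in> I" for i
      unfolding b'_def using coeffs(2) i0(1) that q by (intro K(1,2)) auto
    show "(\<Sum>j\<in>J. c' i j * s j) = b' i" if "i \<in> I" for i
      unfolding c'_sum sol_l[OF that] sol_l[OF i0(1)] b'_def q_def
      using i0(2) by (simp add: field_simps)
    fix w j
    assume w: "\<And>i. i \<in> I \<Longrightarrow> (\<Sum>j\<in>J. c' i j * w j) = 0" and j: "j \<in> J"
    \<comment> \<open>A homogeneous solution of the reduced system extends to the full one: the
      pivot equation dictates the entry at \<open>l\<close>.\<close>
    define w' where "w' = w(l := - (\<Sum>j\<in>J. c i0 j * w j) / c i0 l)"
    have w'_J: "(\<Sum>j\<in>J. c i j * w' j) = (\<Sum>j\<in>J. c i j * w j)" for i
      using fin by (intro sum.cong) (auto simp: w'_def)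
    have "(\<Sum>j\<in>insert l J. c i j * w' j) = 0" if "i \<in> I" for i
      using w[OF that] fin by (simp add: w'_J c'_sum q_def) (simp add: w'_def)
    from uniq[OF this, of j] show "w j = 0" using j fin by (auto simp: w'_def split: if_splits)
  qed
  have "s l = (b i0 - (\<Sum>j\<in>J. c i0 j * s j)) / c i0 l"
    using sol_l[OF i0(1)] i0(2) by simp
  moreover have "(\<Sum>j\<in>J. c i0 j * s j) \<in> K"
  proof -
    have "0 \<in> K" using K(1)[OF coeffs(2)[OF i0(1)] coeffs(2)[OF i0(1)]] by simp
    then have add: "u + v \<in> K" if "u \<in> K" "v \<in> K" for u v
      using K(1)[OF that(1) K(1)[OF \<open>0 \<in> K\<close> that(2)]] by simp
    have "(\<Sum>j\<in>J'. c i0 j * s j) \<in> K" if "J' \<subseteq> J" for J'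
    proof -
      have "finite J'" using that fin by (auto intro: finite_subset)
      then show ?thesis using that
      proof (induction J' rule: finite_induct)
        case empty
        then show ?case using \<open>0 \<in> K\<close> by simp
      next
        case (insert j J')
        then show ?case using coeffs(1)[OF i0(1)] J by (auto intro!: add K(2))
      qed
    qed
    then show ?thesis by simp
  qed
  ultimately have "s l \<in> K"
    using coeffs i0(1) by (auto intro!: K(1,3))
  with J insert.prems(1) show ?case by blast
qed simp

section \<open>Curvatures as rational functions in partial derivatives\<close>

definition partials_field :: "nat \<Rightarrow> (nat \<Rightarrow> 'v mpol) \<Rightarrow> ('v \<Rightarrow> complex fls) \<Rightarrow> complex fls set" where
  "partials_field r f a = {mpol_eval fls_const a P / mpol_eval fls_const a Q | P Q.
     P \<in> partials_algebra r f \<and> Q \<in> partials_algebra r f \<and> mpol_eval fls_const a Q \<noteq> 0}"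

lemma partials_fieldI:
  assumes "P \<in> partials_algebra r f" "Q \<in> partials_algebra r f" "mpol_eval fls_const a Q \<noteq> 0"
    and "y = mpol_eval fls_const a P / mpol_eval fls_const a Q"
  shows "y \<in> partials_field r f a"
  using assms by (auto simp: partials_field_def)

lemma partials_fieldE:
  assumes "y \<in> partials_field r f a"
  obtains P Q where "P \<in> partials_algebra r f" "Q \<in> partials_algebra r f"
    "mpol_eval fls_const a Q \<noteq> 0" "y = mpol_eval fls_const a P / mpol_eval fls_const a Q"
  using assms by (auto simp: partials_field_def)

lemma partials_field_eval:
  assumes "P \<in> partials_algebra r f"
  shows "mpol_eval fls_const a P \<in> partials_field r f a"
  by (rule partials_fieldI[OF assms partials_algebra.const[where c = 1]]) auto

lemma partials_field_const: "fls_const c \<in> partials_field r f a"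
  using partials_field_eval[OF partials_algebra.const[where c = c], of a r f] by simp

lemma partials_field_add:
  assumes "y \<in> partials_field r f a" "z \<in> partials_field r f a"
  shows "y + z \<in> partials_field r f a"
proof -
  from assms(1) obtain P Q where PQ: "P \<in> partials_algebra r f" "Q \<in> partials_algebra r f"
    "mpol_eval fls_const a Q \<noteq> 0" "y = mpol_eval fls_const a P / mpol_eval fls_const a Q"
    by (rule partials_fieldE)
  from assms(2) obtain R S where RS: "R \<in> partials_algebra r f" "S \<in> partials_algebra r f"
    "mpol_eval fls_const a S \<noteq> 0" "z = mpol_eval fls_const a R / mpol_eval fls_const a S"
    by (rule partials_fieldE)
  show ?thesis
    by (rule partials_fieldI[of "P * S + R * Q" _ _ "Q * S"])
      (use PQ(1-3) RS(1-3) in \<open>auto intro: partials_algebra.intros simp: PQ(4) RS(4) field_simps\<close>)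
qed

lemma partials_field_mult:
  assumes "y \<in> partials_field r f a" "z \<in> partials_field r f a"
  shows "y * z \<in> partials_field r f a"
proof -
  from assms(1) obtain P Q where PQ: "P \<in> partials_algebra r f" "Q \<in> partials_algebra r f"
    "mpol_eval fls_const a Q \<noteq> 0" "y = mpol_eval fls_const a P / mpol_eval fls_const a Q"
    by (rule partials_fieldE)
  from assms(2) obtain R S where RS: "R \<in> partials_algebra r f" "S \<in> partials_algebra r f"
    "mpol_eval fls_const a S \<noteq> 0" "z = mpol_eval fls_const a R / mpol_eval fls_const a S"
    by (rule partials_fieldE)
  show ?thesis
    by (rule partials_fieldI[of "P * R" _ _ "Q * S"])
      (use PQ(1-3) RS(1-3) in \<open>auto intro: partials_algebra.intros simp: PQ(4) RS(4) field_simps\<close>)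
qed

lemma partials_field_diff:
  assumes "y \<in> partials_field r f a" "z \<in> partials_field r f a"
  shows "y - z \<in> partials_field r f a"
  using partials_field_add[OF assms(1) partials_field_mult[OF partials_field_const[of "-1"] assms(2)]]
  by (simp add: fls_const_uminus)

lemma partials_field_divide:
  assumes "y \<in> partials_field r f a" "z \<in> partials_field r f a"
  shows "y / z \<in> partials_field r f a"
proof -
  from assms(2) obtain R S where RS: "R \<in> partials_algebra r f" "S \<in> partials_algebra r f"
    "mpol_eval fls_const a S \<noteq> 0" "z = mpol_eval fls_const a R / mpol_eval fls_const a S"
    by (rule partials_fieldE)
  have "inverse z \<in> partials_field r f a"
  \<comment> \<open>Since \<open>inverse 0 = 0\<close>, closure under division includes division by
    zero, as the elimination demands.\<close>
  proof (cases "z = 0")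
    case True
    then show ?thesis using partials_field_const[of 0 r f a] by simp
  next
    case False
    then show ?thesis using RS by (intro partials_fieldI[of S r f R]) auto
  qed
  then show ?thesis using partials_field_mult[OF assms(1)] by (simp add: divide_inverse)
qed

lemma partials_field_sum:
  "(\<And>i. i \<in> I \<Longrightarrow> g i \<in> partials_field r f a) \<Longrightarrow> (\<Sum>i\<in>I. g i) \<in> partials_field r f a"
  using partials_field_const[of 0 r f a]
  by (induction I rule: infinite_finite_induct) (auto intro: partials_field_add)

lemma partials_algebra_mpol_deriv:
  "P \<in> partials_algebra r f \<Longrightarrow> mpol_deriv v P \<in> partials_algebra r f"
proof (induction rule: partials_algebra.induct)
  case (const c)
  show ?case using partials_algebra.const[where c = 0] by simp
next
  case (gen k vs)
  then show ?case using partials_algebra.gen[of k r "v # vs" f, OF gen] by simp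
qed (auto intro: partials_algebra.intros)

lemma partials_field_mpol_eval:
  assumes "\<And>v. a v \<in> partials_field r f b"
  shows "mpol_eval fls_const a P \<in> partials_field r f b"
  by (induction P rule: mpol_induct)
    (auto intro: partials_field_const partials_field_add partials_field_mult assms)

lemma fps_to_fls_mpol_eval:
  "fps_to_fls (mpol_eval fps_const a P) = mpol_eval fls_const (\<lambda>v. fps_to_fls (a v)) P"
  by (rule fps_const.mpol_eval_hom) (simp_all add: fls_times_fps_to_fls fls_const.coeff_hom_axioms)

lemma x_deriv_mpol_eval:
  fixes \<gamma> :: "'n::finite option \<Rightarrow> complex fps"
  assumes x: "fps_deriv (\<gamma> None) \<noteq> 0"
  shows "x_deriv \<gamma> (mpol_eval fls_const (\<lambda>v. fps_to_fls (\<gamma> v)) P) =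
    mpol_eval fls_const (\<lambda>v. fps_to_fls (\<gamma> v)) (mpol_deriv None P) +
    (\<Sum>j\<in>UNIV. mpol_eval fls_const (\<lambda>v. fps_to_fls (\<gamma> v)) (mpol_deriv (Some j) P) * curvature \<gamma> j 0)"
  by (subst fls_const.mpol_eval_chain_rule)
    (simp_all add: UNIV_option_conv sum.reindex x_deriv_x[where \<gamma> = \<gamma>, OF x] x_deriv_y)

lemma slope_in_partials_field:
  fixes \<gamma> :: "'n::finite option \<Rightarrow> complex fps"
  assumes par: "parametrization r f \<gamma>" and x: "fps_deriv (\<gamma> None) \<noteq> 0"
  shows "curvature \<gamma> j 0 \<in> partials_field r f (\<lambda>v. fps_to_fls (\<gamma> v))"
proof -
  define ev where "ev = mpol_eval fls_const (\<lambda>v. fps_to_fls (\<gamma> v))"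
  show ?thesis
  proof (rule linear_system_solution_in_subfield[where J = UNIV and I = "{1..r}" and s = "\<lambda>j. curvature \<gamma> j 0"
      and c = "\<lambda>k j. ev (mpol_deriv (Some j) (f k))" and b = "\<lambda>k. - ev (mpol_deriv None (f k))"])
    have gen: "f k \<in> partials_algebra r f" if "k \<in> {1..r}" for k
      using partials_algebra.gen[of k r "[]" f] that by simp
    show "ev (mpol_deriv (Some j) (f k)) \<in> partials_field r f (\<lambda>v. fps_to_fls (\<gamma> v))" if "k \<in> {1..r}" for k j
      unfolding ev_def by (intro partials_field_eval partials_algebra_mpol_deriv gen that)
    show "- ev (mpol_deriv None (f k)) \<in> partials_field r f (\<lambda>v. fps_to_fls (\<gamma> v))" if "k \<in> {1..r}" for k
      using partials_field_diff[OF partials_field_const[of 0] partials_field_eval[OF partials_algebra_mpol_deriv[OF gen[OF that]]]]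
      by (simp add: ev_def)
    show "(\<Sum>j\<in>UNIV. ev (mpol_deriv (Some j) (f k)) * curvature \<gamma> j 0) = - ev (mpol_deriv None (f k))"
      if "k \<in> {1..r}" for k
    proof -
      have "ev (f k) = 0"
        using equation_vanishes_on_parametrization[OF par that] by (simp add: ev_def flip: fps_to_fls_mpol_eval)
      then have "x_deriv \<gamma> (ev (f k)) = 0" by simp
      then show ?thesis
        using x_deriv_mpol_eval[where \<gamma> = \<gamma> and P = "f k", OF x]
        by (simp add: ev_def eq_neg_iff_add_eq_0 add.commute)
    qed
    fix w j
    assume w: "\<And>k. k \<in> {1..r} \<Longrightarrow> (\<Sum>j\<in>UNIV. ev (mpol_deriv (Some j) (f k)) * w j) = 0"
    \<comment> \<open>The homogeneous solution consists of Laurent series; clearing denominators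
      turns it into a vertical tangent vector of power series.\<close>
    obtain n b where b: "\<And>j. j \<in> UNIV \<Longrightarrow> fls_X ^ n * w j = fps_to_fls (b j)"
      using fls_common_denominator[of UNIV w] by auto
    have "b j = 0"
    proof (rule vertical_tangent_vector_eq_0[OF par x])
      fix k assume k: "k \<in> {1..r}"
      have "fps_to_fls (\<Sum>j\<in>UNIV. mpol_eval fps_const \<gamma> (mpol_deriv (Some j) (f k)) * b j) =
          (\<Sum>j\<in>UNIV. ev (mpol_deriv (Some j) (f k)) * (fls_X ^ n * w j))"
        by (simp only: fps_to_fls_sum fls_times_fps_to_fls fps_to_fls_mpol_eval b[OF UNIV_I] ev_def)
      also have "\<dots> = fls_X ^ n * (\<Sum>j\<in>UNIV. ev (mpol_deriv (Some j) (f k)) * w j)"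
        by (simp only: sum_distrib_left mult.left_commute)
      also have "\<dots> = 0" using w[OF k] by simp
      finally show "(\<Sum>j\<in>UNIV. mpol_eval fps_const \<gamma> (mpol_deriv (Some j) (f k)) * b j) = 0" by simp
    qed
    then show "w j = 0" using b[of j] by simp
  qed (auto intro: partials_field_diff partials_field_mult partials_field_divide)
qed

text \<open>By the chain rule, D of a polynomial involves only its partial derivatives and the
  slopes, and the latter already lie in the field; the quotient rule does the rest.\<close>

lemma x_deriv_in_partials_field:
  fixes \<gamma> :: "'n::finite option \<Rightarrow> complex fps"
  assumes par: "parametrization r f \<gamma>" and x: "fps_deriv (\<gamma> None) \<noteq> 0"
    and y: "y \<in> partials_field r f (\<lambda>v. fps_to_fls (\<gamma> v))"
  shows "x_deriv \<gamma> y \<in> partials_field r f (\<lambda>v. fps_to_fls (\<gamma> v))"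
proof -
  define ev where "ev = mpol_eval fls_const (\<lambda>v. fps_to_fls (\<gamma> v))"
  have D: "x_deriv \<gamma> (ev P) \<in> partials_field r f (\<lambda>v. fps_to_fls (\<gamma> v))" if "P \<in> partials_algebra r f" for P
    unfolding ev_def x_deriv_mpol_eval[where \<gamma> = \<gamma>, OF x]
    by (intro partials_field_add partials_field_sum partials_field_mult partials_field_eval
        partials_algebra_mpol_deriv that slope_in_partials_field[where \<gamma> = \<gamma>, OF par x])
  from y obtain P Q where PQ: "P \<in> partials_algebra r f" "Q \<in> partials_algebra r f" "ev Q \<noteq> 0" "y = ev P / ev Q"
    unfolding ev_def by (rule partials_fieldE)
  have "x_deriv \<gamma> y = (x_deriv \<gamma> (ev P) * ev Q - ev P * x_deriv \<gamma> (ev Q)) / (ev Q * ev Q)"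
    unfolding PQ(4) x_deriv_def
    by (simp add: fls_deriv_divide[OF PQ(3)] power2_eq_square diff_divide_distrib mult_ac)
  also have "\<dots> \<in> partials_field r f (\<lambda>v. fps_to_fls (\<gamma> v))"
    using D[OF PQ(1)] D[OF PQ(2)] partials_field_eval[OF PQ(1)] partials_field_eval[OF PQ(2)]
    unfolding ev_def by (intro partials_field_divide partials_field_diff partials_field_mult)
  finally show ?thesis .
qed

lemma curvature_in_partials_field:
  fixes \<gamma> :: "'n::finite option \<Rightarrow> complex fps"
  assumes par: "parametrization r f \<gamma>" and x: "fps_deriv (\<gamma> None) \<noteq> 0"
  shows "curvature \<gamma> j i \<in> partials_field r f (\<lambda>v. fps_to_fls (\<gamma> v))"
proof (induction i)
  case 0
  show ?case by (rule slope_in_partials_field[where \<gamma> = \<gamma>, OF par x])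
next
  case (Suc i)
  then show ?case
    unfolding curvature_Suc[where \<gamma> = \<gamma>, OF x] by (rule x_deriv_in_partials_field[where \<gamma> = \<gamma>, OF par x])
qed

section \<open>Transport along reparametrizations and the equivalence\<close>

lemma reparamsE:
  assumes "\<delta> \<in> reparams \<gamma> p"
  obtains \<phi> where "\<delta> = reparam \<gamma> \<phi>" "subdegree \<phi> = 1" "rat_defined (jet (reparam \<gamma> \<phi>)) p"
  using assms by (auto simp: reparams_def)

lemma fls_reparam:
  assumes "subdegree \<phi> = 1"
  shows "fps_to_fls (reparam \<gamma> \<phi> v) = fls_compose_fps (fps_to_fls (\<gamma> v)) \<phi>"
  using subdegree_1D[OF assms] by (simp add: reparam_def)

lemma mpol_eval_reparam:
  assumes "subdegree \<phi> = 1"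
  shows "mpol_eval fls_const (\<lambda>v. fps_to_fls (reparam \<gamma> \<phi> v)) P =
    fls_compose_fps (mpol_eval fls_const (\<lambda>v. fps_to_fls (\<gamma> v)) P) \<phi>"
  by (simp only: fls_reparam[OF assms] fls_compose_mpol_eval[OF assms])

text \<open>Expressions for p are found along \<open>\<gamma>\<close> and carried to its
  reparametrizations by composition, an injective ring homomorphism under which curvatures and
  values of polynomials on the curve correspond. So the same expressions serve all members of
  \<open>reparams\<close>.\<close>

theorem theorem1p1:
  fixes X :: "('n::finite option \<Rightarrow> complex) set"
    and r :: nat
    and f :: "nat \<Rightarrow> 'n option mpol"
    and \<gamma> :: "'n option \<Rightarrow> complex fps"
    and p :: "('n option \<times> nat) ratexp"
  assumes curve: "algebraic_curve X"
    and equations: "X = zero_locus (f ` {1..r})"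
    and radical: "radical_ideal (ideal_gen r f)"
    and parametrization: "parametrization r f \<gamma>"
    and slopes_exist: "fps_deriv (\<gamma> None) \<noteq> 0"
    and derivatives: "in_derivatives p"
    and defined: "rat_defined (jet \<gamma>) p"
  defines "cond_i \<equiv> geometric_invariant \<gamma> p"
    and "cond_ii \<equiv>
      (\<exists>q :: ('n \<times> nat) ratexp. \<forall>\<delta>\<in>reparams \<gamma> p.
         rat_defined (slopes_curvatures \<delta>) q \<and>
         rat_eval (jet \<delta>) p = rat_eval (slopes_curvatures \<delta>) q) \<and>
      (\<forall>\<delta>\<in>reparams \<gamma> p. i_kappa_invariant \<delta> p)"
    and "cond_iii \<equiv>
      (\<exists>p1\<in>partials_algebra r f. \<exists>p2\<in>partials_algebra r f. \<forall>\<delta>\<in>reparams \<gamma> p.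
         mpol_eval fls_const (\<lambda>v. fps_to_fls (\<delta> v)) p2 \<noteq> 0 \<and>
         rat_eval (jet \<delta>) p =
           mpol_eval fls_const (\<lambda>v. fps_to_fls (\<delta> v)) p1 /
           mpol_eval fls_const (\<lambda>v. fps_to_fls (\<delta> v)) p2)"
  shows "(cond_i \<longleftrightarrow> cond_ii) \<and> (cond_ii \<longleftrightarrow> cond_iii)"
proof -
  note x = slopes_exist
  have x0: "fps_nth (\<gamma> None) 0 = 0" using parametrization by (simp add: parametrization_def)
  \<comment> \<open>The identity reparametrization makes \<open>\<gamma>\<close> a member of its own
    family, as p is defined along it.\<close>
  have "\<gamma> = reparam \<gamma> fps_X" by simp
  then have \<gamma>: "\<gamma> \<in> reparams \<gamma> p"
    using defined unfolding reparams_def by (intro CollectI exI[of _ fps_X]) simp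
  have "cond_ii" and "cond_iii" if inv: "cond_i"
  proof -
    have equivariant: "rat_eval (jet (reparam \<gamma> \<phi>)) p = fls_compose_fps (rat_eval (jet \<gamma>) p) \<phi>"
      if "subdegree \<phi> = 1" "rat_defined (jet (reparam \<gamma> \<phi>)) p" for \<phi>
      using inv that by (simp add: cond_i_def geometric_invariant_def)
    note curvatures = geometric_invariant_imp_curvatures[where \<gamma> = \<gamma> and p = p,
        OF x x0 derivatives defined inv[unfolded cond_i_def]]
    obtain q where q: "rat_defined (slopes_curvatures \<gamma>) q"
      "rat_eval (jet \<gamma>) p = rat_eval (slopes_curvatures \<gamma>) q"
      using curvatures(1) by blast
    have "rat_defined (slopes_curvatures \<delta>) q \<and> rat_eval (jet \<delta>) p = rat_eval (slopes_curvatures \<delta>) q"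
      if "\<delta> \<in> reparams \<gamma> p" for \<delta>
      using that
    proof (rule reparamsE)
      fix \<phi>
      assume \<phi>: "\<delta> = reparam \<gamma> \<phi>" "subdegree \<phi> = 1" "rat_defined (jet (reparam \<gamma> \<phi>)) p"
      have \<kappa>: "slopes_curvatures \<delta> = (\<lambda>w. fls_compose_fps (slopes_curvatures \<gamma> w) \<phi>)"
        by (rule ext) (simp only: \<phi>(1) slopes_curvatures_reparam[where \<gamma> = \<gamma>, OF \<phi>(2) x])
      show ?thesis
        using q(1) subdegree_1D[OF \<phi>(2)]
        unfolding rat_defined_def \<kappa> fls_compose_mpol_eval[OF \<phi>(2), symmetric]
          fls_compose_rat_eval[OF \<phi>(2), symmetric] q(2)[symmetric]
        by (simp add: \<phi>(1) equivariant[OF \<phi>(2,3)] fls_compose_fps_eq_0_iff)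
    qed
    moreover have "i_kappa_invariant \<delta> p" if "\<delta> \<in> reparams \<gamma> p" for \<delta>
      using that
    proof (rule reparamsE)
      fix \<phi>
      assume \<phi>: "\<delta> = reparam \<gamma> \<phi>" "subdegree \<phi> = 1" "rat_defined (jet (reparam \<gamma> \<phi>)) p"
      note \<phi>0 = subdegree_1D[OF \<phi>(2)]
      let ?p0 = "rat_eval (jet \<gamma>) p"
      have i\<kappa>: "mpol_eval fls_const (i_kappa \<delta>) P = fls_compose_fps (mpol_eval fls_const (i_kappa \<gamma>) P) \<phi>" for P
        by (simp only: fls_compose_mpol_eval[OF \<phi>(2)] \<phi>(1) i_kappa_reparam[where \<gamma> = \<gamma>, OF \<phi>(2) x, abs_def])
      have "mpol_eval fls_const (jet \<gamma>) (fst p) = ?p0 * mpol_eval fls_const (jet \<gamma>) (snd p)"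
        using defined by (simp add: rat_eval_def rat_defined_def)
      \<comment> \<open>Cancelling the nonzero denominator along \<open>\<gamma>\<close> leaves an
        equation between the \<open>i_kappa\<close> values of numerator and denominator that
        composition with \<open>\<phi>\<close> preserves.\<close>
      then have "mpol_eval fls_const (jet \<gamma>) (snd p) * (?p0 * mpol_eval fls_const (i_kappa \<gamma>) (snd p)) =
          mpol_eval fls_const (jet \<gamma>) (snd p) * mpol_eval fls_const (i_kappa \<gamma>) (fst p)"
        using curvatures(2) by (simp add: i_kappa_invariant_def mult_ac)
      then have "?p0 * mpol_eval fls_const (i_kappa \<gamma>) (snd p) = mpol_eval fls_const (i_kappa \<gamma>) (fst p)"
        using defined by (simp add: rat_defined_def)
      then have eq: "fls_compose_fps ?p0 \<phi> * mpol_eval fls_const (i_kappa \<delta>) (snd p) = mpol_eval fls_const (i_kappa \<delta>) (fst p)"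
        unfolding i\<kappa> using \<phi>0 by (simp flip: fls_compose_fps_mult)
      moreover have "mpol_eval fls_const (jet \<delta>) (fst p) = fls_compose_fps ?p0 \<phi> * mpol_eval fls_const (jet \<delta>) (snd p)"
        using \<phi>(3) unfolding equivariant[OF \<phi>(2,3), symmetric] by (simp add: rat_eval_def rat_defined_def \<phi>(1))
      ultimately show ?thesis
        by (simp add: i_kappa_invariant_def mult_ac flip: eq)
    qed
    ultimately show "cond_ii" unfolding cond_ii_def by blast
    have "slopes_curvatures \<gamma> w \<in> partials_field r f (\<lambda>v. fps_to_fls (\<gamma> v))" for w
      using curvature_in_partials_field[where \<gamma> = \<gamma>, OF parametrization x]
      by (simp add: slopes_curvatures_def split: prod.split)
    then have "rat_eval (jet \<gamma>) p \<in> partials_field r f (\<lambda>v. fps_to_fls (\<gamma> v))"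
      unfolding q(2) unfolding rat_eval_def by (intro partials_field_divide partials_field_mpol_eval)
    then obtain P Q where PQ: "P \<in> partials_algebra r f" "Q \<in> partials_algebra r f"
      "mpol_eval fls_const (\<lambda>v. fps_to_fls (\<gamma> v)) Q \<noteq> 0"
      "rat_eval (jet \<gamma>) p = mpol_eval fls_const (\<lambda>v. fps_to_fls (\<gamma> v)) P / mpol_eval fls_const (\<lambda>v. fps_to_fls (\<gamma> v)) Q"
      by (rule partials_fieldE)
    have "mpol_eval fls_const (\<lambda>v. fps_to_fls (\<delta> v)) Q \<noteq> 0 \<and> rat_eval (jet \<delta>) p =
           mpol_eval fls_const (\<lambda>v. fps_to_fls (\<delta> v)) P / mpol_eval fls_const (\<lambda>v. fps_to_fls (\<delta> v)) Q"
      if "\<delta> \<in> reparams \<gamma> p" for \<delta>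
      using that
    proof (rule reparamsE)
      fix \<phi>
      assume \<phi>: "\<delta> = reparam \<gamma> \<phi>" "subdegree \<phi> = 1" "rat_defined (jet (reparam \<gamma> \<phi>)) p"
      show ?thesis
        unfolding \<phi>(1) mpol_eval_reparam[OF \<phi>(2)] equivariant[OF \<phi>(2,3)] PQ(4)
        using PQ(3) subdegree_1D[OF \<phi>(2)] by (simp add: fls_compose_fps_eq_0_iff fls_compose_fps_divide)
    qed
    with PQ(1,2) show "cond_iii" unfolding cond_iii_def by blast
  qed
  moreover have "cond_i" if ii: "cond_ii"
    unfolding cond_i_def geometric_invariant_def
  proof (intro allI impI)
    fix \<phi> assume \<phi>: "subdegree \<phi> = 1 \<and> rat_defined (jet (reparam \<gamma> \<phi>)) p"
    then have mem: "reparam \<gamma> \<phi> \<in> reparams \<gamma> p" by (auto simp: reparams_def)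
    \<comment> \<open>One \<open>q\<close> represents p along both \<open>\<gamma>\<close> and its
      reparametrization, so equivariance is inherited from the curvatures.\<close>
    from ii obtain q where q: "\<And>\<delta>. \<delta> \<in> reparams \<gamma> p \<Longrightarrow> rat_eval (jet \<delta>) p = rat_eval (slopes_curvatures \<delta>) q"
      unfolding cond_ii_def by blast
    have \<kappa>: "slopes_curvatures (reparam \<gamma> \<phi>) = (\<lambda>w. fls_compose_fps (slopes_curvatures \<gamma> w) \<phi>)"
      by (rule ext) (simp only: slopes_curvatures_reparam[where \<gamma> = \<gamma>, OF conjunct1[OF \<phi>] x])
    show "fls_compose_fps (rat_eval (jet \<gamma>) p) \<phi> = rat_eval (jet (reparam \<gamma> \<phi>)) p"
      unfolding q[OF mem] q[OF \<gamma>] \<kappa> by (rule fls_compose_rat_eval[OF conjunct1[OF \<phi>]])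
  qed
  moreover have "cond_i" if iii: "cond_iii"
    unfolding cond_i_def geometric_invariant_def
  proof (intro allI impI)
    fix \<phi> assume \<phi>: "subdegree \<phi> = 1 \<and> rat_defined (jet (reparam \<gamma> \<phi>)) p"
    then have mem: "reparam \<gamma> \<phi> \<in> reparams \<gamma> p" by (auto simp: reparams_def)
    from iii obtain P Q where PQ: "\<And>\<delta>. \<delta> \<in> reparams \<gamma> p \<Longrightarrow> rat_eval (jet \<delta>) p =
        mpol_eval fls_const (\<lambda>v. fps_to_fls (\<delta> v)) P / mpol_eval fls_const (\<lambda>v. fps_to_fls (\<delta> v)) Q"
      unfolding cond_iii_def by blast
    show "fls_compose_fps (rat_eval (jet \<gamma>) p) \<phi> = rat_eval (jet (reparam \<gamma> \<phi>)) p"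
      unfolding PQ[OF mem] PQ[OF \<gamma>] mpol_eval_reparam[OF conjunct1[OF \<phi>]]
      using subdegree_1D[OF conjunct1[OF \<phi>]] by (simp add: fls_compose_fps_divide)
  qed
  ultimately show ?thesis by blast
qed

end
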